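(* Let $G$ be a finite group of $F$-class $c\ge 1$ with covering group $G^*$ and multiplicator $M$, and let $U_1, U_2$ be allowable subgroups of $G^*$. Then $G^*/U_1 \cong G^*/U_2$ if and only if there exists $\alpha \in \mathrm{Aut}_M(G^* )$ with $\alpha(U_1) = U_2$.
   Context: For a finite group $X$, $F(X)$ is its Fitting subgroup; the $F$-central series is $\nu_0(X)=F(X)$ and $\nu_{i+1}(X)$ is the smallest normal subgroup $N'$ of $F(X)$ with $N'\le\nu_i(X)$ such that $\nu_i(X)/N'$ is centralized by $F(X)$ and is a direct product of elementary abelian groups; the $F$-class is the least $c$ with $\nu_c(X)=1$, and the $F$-rank is $|\nu_0(X)/\nu_1(X)|$. Covering group: with $g_1,\dots,g_n$ generating $G$, $F$ free on $f_1,\dots,f_n$, $\mu:F\to G$, $f_i\mapsto g_i$, $R=\ker\mu$, $L=\mu^{-1}(F(G))$, $k$ the product of the distinct primes dividing the $F$-rank of $G$: $G^*=F/[R,L]R^k$, $M=R/[R,L]R^k$. The nucleus is $N=\nu_c(G^* )$. A subgroup $U$ of $G^*$ is allowable if $U$ is a proper subgroup of $M$, normal in $G^*$, with $M=NU$. $\mathrm{Aut}_M(G^* )$ denotes the group of automorphisms of $G^*$ leaving $M$ setwise invariant. *)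

theory Defs
  imports "HOL-Algebra.Algebra" "HOL-Computational_Algebra.Primes" "HOL-Computational_Algebra.Squarefree"
begin

definition comm_sub :: "('a,'b) monoid_scheme \<Rightarrow> 'a set \<Rightarrow> 'a set \<Rightarrow> 'a set" where
  "comm_sub G A B = generate G
     {a \<otimes>\<^bsub>G\<^esub> b \<otimes>\<^bsub>G\<^esub> inv\<^bsub>G\<^esub> a \<otimes>\<^bsub>G\<^esub> inv\<^bsub>G\<^esub> b | a b. a \<in> A \<and> b \<in> B}"

primrec lower_central :: "('a,'b) monoid_scheme \<Rightarrow> 'a set \<Rightarrow> nat \<Rightarrow> 'a set" where
  "lower_central G H 0 = H"
| "lower_central G H (Suc i) = comm_sub G (lower_central G H i) H"

definition nilpotent_subgroup :: "('a,'b) monoid_scheme \<Rightarrow> 'a set \<Rightarrow> bool" where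
  "nilpotent_subgroup G H \<longleftrightarrow> subgroup H G \<and> (\<exists>i. lower_central G H i = {\<one>\<^bsub>G\<^esub>})"

definition fitting :: "('a,'b) monoid_scheme \<Rightarrow> 'a set" where
  "fitting G = generate G (\<Union>{N. normal N G \<and> nilpotent_subgroup G N})"

text \<open>Admissible candidates N' for the next term below V (inside F = F(X)):
  N' normal subgroup of F(X), N' \<le> V, V/N' centralized by F(X), and V/N' a direct
  product of elementary abelian groups (abelian, every element of squarefree order).\<close>
definition nu_cand :: "('a,'b) monoid_scheme \<Rightarrow> 'a set \<Rightarrow> 'a set \<Rightarrow> 'a set \<Rightarrow> bool" where
  "nu_cand Q F V N \<longleftrightarrow>
     normal N (Q\<lparr>carrier := F\<rparr>) \<and> N \<subseteq> V \<and>
     (\<forall>x\<in>V. \<forall>f\<in>F. f \<otimes>\<^bsub>Q\<^esub> x \<otimes>\<^bsub>Q\<^esub> inv\<^bsub>Q\<^esub> f \<otimes>\<^bsub>Q\<^esub> inv\<^bsub>Q\<^esub> x \<in> N) \<and>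
     (\<forall>x\<in>V. \<forall>y\<in>V. x \<otimes>\<^bsub>Q\<^esub> y \<otimes>\<^bsub>Q\<^esub> inv\<^bsub>Q\<^esub> x \<otimes>\<^bsub>Q\<^esub> inv\<^bsub>Q\<^esub> y \<in> N) \<and>
     (\<forall>x\<in>V. \<exists>m::nat. 0 < m \<and> squarefree m \<and> x [^]\<^bsub>Q\<^esub> m \<in> N)"

primrec nu :: "('a,'b) monoid_scheme \<Rightarrow> nat \<Rightarrow> 'a set" where
  "nu Q 0 = fitting Q"
| "nu Q (Suc i) = (THE N. nu_cand Q (fitting Q) (nu Q i) N \<and>
                     (\<forall>N'. nu_cand Q (fitting Q) (nu Q i) N' \<longrightarrow> N \<subseteq> N'))"

definition Fclass :: "('a,'b) monoid_scheme \<Rightarrow> nat" where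
  "Fclass Q = (LEAST c. nu Q c = {\<one>\<^bsub>Q\<^esub>})"

definition Frank :: "('a,'b) monoid_scheme \<Rightarrow> nat" where
  "Frank Q = card (nu Q 0) div card (nu Q 1)"

type_synonym fword = "(nat \<times> bool) list"

definition fwords :: "nat \<Rightarrow> fword set" where
  "fwords n = {w. \<forall>x\<in>set w. fst x < n}"

definition cancel1 :: "fword rel" where
  "cancel1 = {(a @ [(i,b),(i,\<not>b)] @ c, a @ c) | a i b c. True}"

definition free_eq :: "nat \<Rightarrow> fword rel" where
  "free_eq n = ((cancel1 \<union> cancel1\<inverse>) \<inter> (fwords n \<times> fwords n))\<^sup>*"

definition free_group :: "nat \<Rightarrow> fword set monoid" where
  "free_group n = \<lparr>carrier = fwords n // free_eq n,
     monoid.mult = (\<lambda>Q Y. free_eq n `` {(SOME x. x \<in> Q) @ (SOME y. y \<in> Y)}),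
     monoid.one = free_eq n `` {[]}\<rparr>"

definition free_gen :: "nat \<Rightarrow> nat \<Rightarrow> fword set" where
  "free_gen n i = free_eq n `` {[(i, True)]}"

text \<open>Data: G, rank n, and the epimorphism mu : F \<rightarrow> G with f_i \<mapsto> g_i.\<close>

definition cov_R :: "('a,'b) monoid_scheme \<Rightarrow> nat \<Rightarrow> (fword set \<Rightarrow> 'a) \<Rightarrow> fword set set" where
  "cov_R G n \<mu> = kernel (free_group n) G \<mu>"

definition cov_L :: "('a,'b) monoid_scheme \<Rightarrow> nat \<Rightarrow> (fword set \<Rightarrow> 'a) \<Rightarrow> fword set set" where
  "cov_L G n \<mu> = {x \<in> carrier (free_group n). \<mu> x \<in> fitting G}"

definition cov_k :: "('a,'b) monoid_scheme \<Rightarrow> nat" where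
  "cov_k G = \<Prod>(prime_factors (Frank G))"

definition cov_K :: "('a,'b) monoid_scheme \<Rightarrow> nat \<Rightarrow> (fword set \<Rightarrow> 'a) \<Rightarrow> fword set set" where
  "cov_K G n \<mu> =
     comm_sub (free_group n) (cov_R G n \<mu>) (cov_L G n \<mu>) <#>\<^bsub>free_group n\<^esub>
     generate (free_group n) {r [^]\<^bsub>free_group n\<^esub> cov_k G | r. r \<in> cov_R G n \<mu>}"

definition cover_group :: "('a,'b) monoid_scheme \<Rightarrow> nat \<Rightarrow> (fword set \<Rightarrow> 'a) \<Rightarrow> fword set set monoid" where
  "cover_group G n \<mu> = free_group n Mod cov_K G n \<mu>"

definition cov_M :: "('a,'b) monoid_scheme \<Rightarrow> nat \<Rightarrow> (fword set \<Rightarrow> 'a) \<Rightarrow> fword set set set" where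
  "cov_M G n \<mu> = (\<lambda>r. cov_K G n \<mu> #>\<^bsub>free_group n\<^esub> r) ` cov_R G n \<mu>"

definition nucleus :: "('a,'b) monoid_scheme \<Rightarrow> nat \<Rightarrow> (fword set \<Rightarrow> 'a) \<Rightarrow> fword set set set" where
  "nucleus G n \<mu> = nu (cover_group G n \<mu>) (Fclass G)"

definition allowable :: "('a,'b) monoid_scheme \<Rightarrow> nat \<Rightarrow> (fword set \<Rightarrow> 'a) \<Rightarrow> fword set set set \<Rightarrow> bool" where
  "allowable G n \<mu> U \<longleftrightarrow>
     subgroup U (cover_group G n \<mu>) \<and> U \<subset> cov_M G n \<mu> \<and> normal U (cover_group G n \<mu>) \<and>
     cov_M G n \<mu> = nucleus G n \<mu> <#>\<^bsub>cover_group G n \<mu>\<^esub> U"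

definition Aut_M :: "('a,'b) monoid_scheme \<Rightarrow> nat \<Rightarrow> (fword set \<Rightarrow> 'a)
      \<Rightarrow> (fword set set \<Rightarrow> fword set set) set" where
  "Aut_M G n \<mu> = {\<alpha> \<in> iso (cover_group G n \<mu>) (cover_group G n \<mu>). \<alpha> ` cov_M G n \<mu> = cov_M G n \<mu>}"

end

theory Submission
  imports Defs
begin

text \<open>
  The multiplicator \<open>M\<close> is the kernel of \<open>G\<^sup>* \<rightarrow> G\<close> and is central in the preimage of \<open>F(G)\<close>, so the Fitting
  subgroups of \<open>G\<^sup>*\<close> and \<open>G\<^sup>*/U\<close> are the preimages of \<open>F(G)\<close>. The F-central series is compatible with
  epimorphisms that respect Fitting subgroups, hence \<open>\<nu>\<^sub>c(G\<^sup>*/U) = NU/U = M/U\<close> for allowable \<open>U\<close>, and an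
  isomorphism \<open>G\<^sup>*/U\<^sub>1 \<rightarrow> G\<^sup>*/U\<^sub>2\<close> preserves \<open>M\<close> and the Fitting subgroup modulo the \<open>U\<^sub>i\<close>. The covering group
  is finite by Schreier's lemma, so Gaschuetz' lemma lifts the images of the generators to a
  generating tuple of \<open>G\<^sup>*\<close>. The resulting epimorphism from the free group maps \<open>R\<close> to \<open>M\<close> and \<open>L\<close> to \<open>F(G\<^sup>*)\<close>,
  so it kills \<open>[R,L]R\<^sup>k\<close> and induces the required automorphism. The generators need not be minimal,
  so an arbitrary lift of the isomorphism need not be surjective.
\<close>

section \<open>Fitting subgroups and central extensions\<close>

lemma (in group) subgroup_nat_pow_closed:
  fixes m :: nat
  assumes "subgroup S G" "x \<in> S"
  shows "x [^] m \<in> S"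
  using subgroup_int_pow_closed[OF assms, of "int m"] by (simp add: int_pow_int)

lemma (in group) comm_sub_closed:
  assumes "A \<subseteq> carrier G" "B \<subseteq> carrier G"
  shows "comm_sub G A B \<subseteq> carrier G"
  unfolding comm_sub_def using assms by (intro generate_incl) (auto simp: subset_iff)

lemma (in group) lower_central_closed:
  assumes "A \<subseteq> carrier G"
  shows "lower_central G A i \<subseteq> carrier G"
  using assms by (induction i) (auto dest: subsetD[OF comm_sub_closed])

lemma (in group_hom) hom_comm_sub:
  assumes "A \<subseteq> carrier G" "B \<subseteq> carrier G"
  shows "h ` comm_sub G A B = comm_sub H (h ` A) (h ` B)"
proof -
  let ?C = "{a \<otimes>\<^bsub>G\<^esub> b \<otimes>\<^bsub>G\<^esub> inv\<^bsub>G\<^esub> a \<otimes>\<^bsub>G\<^esub> inv\<^bsub>G\<^esub> b | a b. a \<in> A \<and> b \<in> B}"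
  let ?D = "{a \<otimes>\<^bsub>H\<^esub> b \<otimes>\<^bsub>H\<^esub> inv\<^bsub>H\<^esub> a \<otimes>\<^bsub>H\<^esub> inv\<^bsub>H\<^esub> b | a b. a \<in> h ` A \<and> b \<in> h ` B}"
  have comm: "h (a \<otimes>\<^bsub>G\<^esub> b \<otimes>\<^bsub>G\<^esub> inv\<^bsub>G\<^esub> a \<otimes>\<^bsub>G\<^esub> inv\<^bsub>G\<^esub> b)
      = h a \<otimes>\<^bsub>H\<^esub> h b \<otimes>\<^bsub>H\<^esub> inv\<^bsub>H\<^esub> h a \<otimes>\<^bsub>H\<^esub> inv\<^bsub>H\<^esub> h b" if "a \<in> A" "b \<in> B" for a b
    using that assms by (simp add: subset_iff)
  have "h ` ?C = ?D"
  proof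
    show "h ` ?C \<subseteq> ?D"
      using comm by blast
    show "?D \<subseteq> h ` ?C"
    proof
      fix x assume "x \<in> ?D"
      then obtain a b where "a \<in> A" "b \<in> B"
        and "x = h a \<otimes>\<^bsub>H\<^esub> h b \<otimes>\<^bsub>H\<^esub> inv\<^bsub>H\<^esub> h a \<otimes>\<^bsub>H\<^esub> inv\<^bsub>H\<^esub> h b"
        by blast
      with comm show "x \<in> h ` ?C"
        by (intro image_eqI[of _ _ "a \<otimes>\<^bsub>G\<^esub> b \<otimes>\<^bsub>G\<^esub> inv\<^bsub>G\<^esub> a \<otimes>\<^bsub>G\<^esub> inv\<^bsub>G\<^esub> b"]) auto
    qed
  qed
  moreover have "?C \<subseteq> carrier G"
    using assms by (auto simp: subset_iff)
  ultimately show ?thesis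
    unfolding comm_sub_def using generate_img[of ?C] by simp
qed

lemma (in group_hom) hom_lower_central:
  assumes "A \<subseteq> carrier G"
  shows "h ` lower_central G A i = lower_central H (h ` A) i"
  using assms by (induction i) (simp_all add: hom_comm_sub G.lower_central_closed)

lemma (in group_hom) subgroup_preimage:
  assumes "subgroup N H"
  shows "subgroup {x \<in> carrier G. h x \<in> N} G"
  using subgroup.one_closed[OF assms] subgroup.m_closed[OF assms] subgroup.m_inv_closed[OF assms]
  by (intro subgroup.intro) auto

lemma (in group_hom) normal_preimage:
  assumes "N \<lhd> H"
  shows "{x \<in> carrier G. h x \<in> N} \<lhd> G"
  using H.normal_invE[OF assms]
  by (intro G.normal_invI subgroup_preimage) auto

lemma (in group) comm_sub_central:
  assumes "A \<subseteq> carrier G" "B \<subseteq> carrier G"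
    and "\<And>a b. a \<in> A \<Longrightarrow> b \<in> B \<Longrightarrow> a \<otimes> b = b \<otimes> a"
  shows "comm_sub G A B = {\<one>}"
proof -
  have "a \<otimes> b \<otimes> inv a \<otimes> inv b = \<one>" if "a \<in> A" "b \<in> B" for a b
  proof -
    have "a \<in> carrier G" "b \<in> carrier G" "a \<otimes> b = b \<otimes> a"
      using that assms by auto
    then show ?thesis
      by (metis inv_closed m_assoc r_inv r_one)
  qed
  then have "{a \<otimes> b \<otimes> inv a \<otimes> inv b | a b. a \<in> A \<and> b \<in> B} \<subseteq> {\<one>}"
    by auto
  from mono_generate[OF this] show ?thesis
    unfolding comm_sub_def generate_one by (auto intro: generate.one)
qed

section \<open>Normal nilpotent subgroups and the Fitting subgroup\<close>

lemma (in group) fitting_subgroup: "subgroup (fitting G) G"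
  unfolding fitting_def
  by (intro generate_is_subgroup) (auto dest: normal_imp_subgroup subgroup.mem_carrier)

lemma (in group) normal_nilpotent_le_fitting:
  assumes "N \<lhd> G" "nilpotent_subgroup G N"
  shows "N \<subseteq> fitting G"
  unfolding fitting_def using assms by (auto intro: generate.incl)

lemma (in group) fitting_least:
  assumes "subgroup P G" "\<And>N. N \<lhd> G \<Longrightarrow> nilpotent_subgroup G N \<Longrightarrow> N \<subseteq> P"
  shows "fitting G \<subseteq> P"
  unfolding fitting_def using assms by (intro generate_subgroup_incl) auto

lemma (in group) fitting_normal: "fitting G \<lhd> G"
proof -
  let ?S = "\<Union>{N. N \<lhd> G \<and> nilpotent_subgroup G N}"
  have "generate G ?S \<lhd> G"
  proof (rule normal_generateI)
    show "?S \<subseteq> carrier G"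
      by (auto dest: normal_imp_subgroup subgroup.mem_carrier)
    show "g \<otimes> x \<otimes> inv g \<in> ?S" if "x \<in> ?S" "g \<in> carrier G" for x g
      using that normal_invE(2) by blast
  qed
  then show ?thesis
    by (simp add: fitting_def)
qed

text \<open>Epimorphisms carry normal nilpotent subgroups to such subgroups, which gives one
  inclusion. For the other, the preimage of a normal nilpotent subgroup has a lower central term
  inside the kernel, and the kernel commutes with that preimage, so one further commutator is
  trivial.\<close>

lemma (in group_hom) fitting_central_extension:
  assumes surj: "h ` carrier G = carrier H"
    and central: "\<And>z x. \<lbrakk>z \<in> kernel G H h; x \<in> carrier G; h x \<in> fitting H\<rbrakk>
      \<Longrightarrow> z \<otimes>\<^bsub>G\<^esub> x = x \<otimes>\<^bsub>G\<^esub> z"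
  shows "fitting G = {x \<in> carrier G. h x \<in> fitting H}"
proof
  show "fitting G \<subseteq> {x \<in> carrier G. h x \<in> fitting H}"
  proof (rule G.fitting_least[OF subgroup_preimage[OF H.fitting_subgroup]])
    fix N assume N: "N \<lhd> G" "nilpotent_subgroup G N"
    then have sub: "N \<subseteq> carrier G" and "subgroup N G"
      by (auto dest: normal_imp_subgroup subgroup.mem_carrier)
    obtain i where "lower_central G N i = {\<one>\<^bsub>G\<^esub>}"
      using N(2) by (auto simp: nilpotent_subgroup_def)
    then have "lower_central H (h ` N) i = {\<one>\<^bsub>H\<^esub>}"
      using hom_lower_central[OF sub, of i] by simp
    moreover have nrm: "h ` N \<lhd> H"
      using normal.surj_hom_normal_subgroup[OF N(1) _ surj] group_hom_axioms by blast
    ultimately have "nilpotent_subgroup H (h ` N)"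
      by (auto simp: nilpotent_subgroup_def dest: normal_imp_subgroup)
    from H.normal_nilpotent_le_fitting[OF nrm this] sub
    show "N \<subseteq> {x \<in> carrier G. h x \<in> fitting H}"
      by auto
  qed
next
  have preimage_nilp: "{x \<in> carrier G. h x \<in> N} \<subseteq> fitting G"
    if N: "N \<lhd> H" "nilpotent_subgroup H N" for N
  proof -
    let ?P = "{x \<in> carrier G. h x \<in> N}"
    have P: "?P \<lhd> G"
      by (rule normal_preimage[OF N(1)])
    obtain i where i: "lower_central H N i = {\<one>\<^bsub>H\<^esub>}"
      using N(2) by (auto simp: nilpotent_subgroup_def)
    have "N \<subseteq> carrier H"
      using N(1) by (auto dest: normal_imp_subgroup subgroup.mem_carrier)
    then have "h ` ?P = N"
      using surj by (auto simp: image_iff)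
    then have "h ` lower_central G ?P i = {\<one>\<^bsub>H\<^esub>}"
      using hom_lower_central[of ?P i] i by auto
    then have ker: "lower_central G ?P i \<subseteq> kernel G H h"
      using G.lower_central_closed[of ?P i] by (auto simp: kernel_def)
    have "lower_central G ?P (Suc i) = {\<one>\<^bsub>G\<^esub>}"
      unfolding lower_central.simps
    proof (rule G.comm_sub_central)
      show "lower_central G ?P i \<subseteq> carrier G"
        by (rule G.lower_central_closed) auto
      show "a \<otimes>\<^bsub>G\<^esub> b = b \<otimes>\<^bsub>G\<^esub> a" if "a \<in> lower_central G ?P i" "b \<in> ?P" for a b
        using that ker central H.normal_nilpotent_le_fitting[OF N] by blast
    qed auto
    then have "nilpotent_subgroup G ?P"
      using P unfolding nilpotent_subgroup_def by (metis normal_imp_subgroup)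
    then show ?thesis
      using G.normal_nilpotent_le_fitting[OF P] by simp
  qed
  have "fitting H \<subseteq> h ` fitting G"
  proof (rule H.fitting_least)
    show "subgroup (h ` fitting G) H"
      by (rule subgroup_img_is_subgroup[OF G.fitting_subgroup])
    show "N \<subseteq> h ` fitting G" if N: "N \<lhd> H" "nilpotent_subgroup H N" for N
    proof
      fix y assume "y \<in> N"
      then have "y \<in> carrier H"
        using N(1) by (auto dest: normal_imp_subgroup subgroup.mem_carrier)
      then obtain x where "x \<in> carrier G" "y = h x"
        using surj by auto
      then show "y \<in> h ` fitting G"
        using preimage_nilp[OF N] \<open>y \<in> N\<close> by auto
    qed
  qed
  \<comment> \<open>The trivial subgroup is nilpotent at index 0 and its preimage is the kernel, so
    the kernel lies in \<open>fitting G\<close>. Elements with equal image then differ by an element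
    of \<open>fitting G\<close>.\<close>
  moreover have "{\<one>\<^bsub>H\<^esub>} \<lhd> H" "nilpotent_subgroup H {\<one>\<^bsub>H\<^esub>}"
    using H.one_is_normal H.triv_subgroup
    by (auto simp: nilpotent_subgroup_def intro!: exI[of _ 0])
  then have ker: "kernel G H h \<subseteq> fitting G"
    using preimage_nilp[of "{\<one>\<^bsub>H\<^esub>}"] by (auto simp: kernel_def)
  ultimately show "{x \<in> carrier G. h x \<in> fitting H} \<subseteq> fitting G"
  proof (intro subsetI)
    fix x assume "x \<in> {x \<in> carrier G. h x \<in> fitting H}"
      and sub: "fitting H \<subseteq> h ` fitting G"
    then obtain y where y: "y \<in> fitting G" "h x = h y" and x: "x \<in> carrier G"
      by blast
    have yc: "y \<in> carrier G"
      using y G.fitting_subgroup subgroup.mem_carrier by metis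
    have "x \<otimes>\<^bsub>G\<^esub> inv\<^bsub>G\<^esub> y \<in> fitting G"
      using ker x y yc by (auto simp: kernel_def)
    then have "x \<otimes>\<^bsub>G\<^esub> inv\<^bsub>G\<^esub> y \<otimes>\<^bsub>G\<^esub> y \<in> fitting G"
      using y G.fitting_subgroup subgroup.m_closed by metis
    then show "x \<in> fitting G"
      using x yc by (simp add: G.m_assoc)
  qed
qed

text \<open>An isomorphism is a central extension with trivial kernel, so
  \<open>fitting_central_extension\<close> applies.\<close>

lemma (in group_hom) fitting_iso:
  assumes "h \<in> iso G H"
  shows "h ` fitting G = fitting H"
proof -
  have bij: "bij_betw h (carrier G) (carrier H)"
    using assms by (simp add: iso_def)
  then have surj: "h ` carrier G = carrier H"
    by (rule bij_betw_imp_surj_on)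
  have "z = \<one>\<^bsub>G\<^esub>" if "z \<in> kernel G H h" for z
    using that inj_iff_trivial_ker bij by (auto simp: bij_betw_def)
  then have "fitting G = {x \<in> carrier G. h x \<in> fitting H}"
    using surj by (intro fitting_central_extension) (metis G.l_one G.r_one)+
  moreover have "fitting H \<subseteq> carrier H"
    using H.fitting_subgroup by (rule subgroup.subset)
  ultimately show ?thesis
    using surj by (auto simp: image_iff)
qed

section \<open>The F-central series\<close>

text \<open>The multiplicity of a prime in the lcm is the larger of its two multiplicities, hence at
  most 1.\<close>

lemma squarefree_lcm_nat:
  fixes a b :: nat
  assumes "squarefree a" "squarefree b"
  shows "squarefree (lcm a b)"
proof -
  have "a \<noteq> 0" "b \<noteq> 0"
    using assms by (metis not_squarefree_0)+
  then show ?thesis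
    using assms
    by (simp add: squarefree_factorial_semiring'' multiplicity_lcm)
qed

section \<open>Candidates for the next term of the F-central series, and the least one\<close>

lemma (in group) normal_in_subgroup_iff:
  assumes "subgroup F G"
  shows "N \<lhd> G\<lparr>carrier := F\<rparr> \<longleftrightarrow>
    subgroup N G \<and> N \<subseteq> F \<and> (\<forall>f\<in>F. \<forall>x\<in>N. f \<otimes> x \<otimes> inv f \<in> N)"
proof -
  interpret F: group "G\<lparr>carrier := F\<rparr>"
    by (rule subgroup_imp_group[OF assms])
  have "subgroup N (G\<lparr>carrier := F\<rparr>) \<longleftrightarrow> subgroup N G \<and> N \<subseteq> F"
    using incl_subgroup[OF assms] subgroup_incl[OF _ assms] subgroup.subset by fastforce
  then show ?thesis
    by (auto simp: F.normal_inv_iff m_inv_consistent[OF assms])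
qed

text \<open>The subgroup, conjugation and commutator conditions pass to intersections directly. In
  the exponent clause the two exponents are replaced by their least common multiple, which stays
  squarefree.\<close>

lemma (in group) nu_cand_inter:
  assumes F: "subgroup F G" and V: "V \<subseteq> F"
    and N: "nu_cand G F V N" and N': "nu_cand G F V N'"
  shows "nu_cand G F V (N \<inter> N')"
  unfolding nu_cand_def normal_in_subgroup_iff[OF F]
proof (intro conjI ballI)
  have sub: "subgroup N G" "subgroup N' G"
    using N N' unfolding nu_cand_def normal_in_subgroup_iff[OF F] by auto
  then show "subgroup (N \<inter> N') G"
    by (rule subgroups_Inter_pair)
  fix x assume x: "x \<in> V"
  then have xc: "x \<in> carrier G"
    using subgroup.mem_carrier[OF F] V by blast
  have exp: "\<exists>m::nat. 0 < m \<and> squarefree m \<and> x [^] m \<in> S" if "nu_cand G F V S" for S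
    using that x unfolding nu_cand_def by simp
  obtain a :: nat where a: "0 < a" "squarefree a" "x [^] a \<in> N"
    using exp[OF N] by auto
  obtain b :: nat where b: "0 < b" "squarefree b" "x [^] b \<in> N'"
    using exp[OF N'] by auto
  have pow: "x [^] (m * k) \<in> S" if "x [^] m \<in> S" "subgroup S G" for m k :: nat and S
    using subgroup_nat_pow_closed[OF that(2,1), of k] xc by (simp add: nat_pow_pow)
  have "x [^] lcm a b \<in> N"
    using pow[OF a(3) sub(1), of "lcm a b div a"] by simp
  moreover have "x [^] lcm a b \<in> N'"
    using pow[OF b(3) sub(2), of "lcm a b div b"] by simp
  ultimately show "\<exists>m::nat. 0 < m \<and> squarefree m \<and> x [^] m \<in> N \<inter> N'"
    using a(1,2) b(1,2) by (intro exI[of _ "lcm a b"]) (simp add: squarefree_lcm_nat lcm_pos_nat)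
qed (use N N' in \<open>auto simp only: nu_cand_def normal_in_subgroup_iff[OF F] Int_iff subset_iff\<close>)

text \<open>Provides a first candidate, with exponent 1 throughout, so that a smallest one can be
  chosen.\<close>

lemma (in group) nu_cand_self:
  assumes F: "subgroup F G" and V: "V \<lhd> G\<lparr>carrier := F\<rparr>"
  shows "nu_cand G F V V"
proof -
  have V': "subgroup V G" "V \<subseteq> F" "\<And>f x. f \<in> F \<Longrightarrow> x \<in> V \<Longrightarrow> f \<otimes> x \<otimes> inv f \<in> V"
    using V unfolding normal_in_subgroup_iff[OF F] by auto
  have comm: "f \<otimes> x \<otimes> inv f \<otimes> inv x \<in> V" if "x \<in> V" "f \<in> F" for x f
    using V' that by (metis subgroup.m_closed subgroup.m_inv_closed)
  have "\<exists>m::nat. 0 < m \<and> squarefree m \<and> x [^] m \<in> V" if "x \<in> V" for x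
    using that subgroup.mem_carrier[OF V'(1)] by (intro exI[of _ 1]) simp
  then show ?thesis
    unfolding nu_cand_def using V comm V'(2) by blast
qed

text \<open>A candidate of least cardinality is contained in every other one: its intersection with
  another candidate is again a candidate and cannot have fewer elements.\<close>

lemma (in group) ex_least_nu_cand:
  assumes "finite (carrier G)" and F: "subgroup F G" and V: "V \<lhd> G\<lparr>carrier := F\<rparr>"
  shows "\<exists>N. nu_cand G F V N \<and> (\<forall>N'. nu_cand G F V N' \<longrightarrow> N \<subseteq> N')"
proof -
  have VF: "V \<subseteq> F" "V \<subseteq> carrier G"
    using V unfolding normal_in_subgroup_iff[OF F] by (auto dest: subgroup.mem_carrier)
  obtain N where N: "nu_cand G F V N"
    and min: "\<And>N'. nu_cand G F V N' \<Longrightarrow> card N \<le> card N'"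
    using ex_has_least_nat[of "nu_cand G F V" V card] nu_cand_self[OF F V] by blast
  have "finite N"
    using N VF assms(1) unfolding nu_cand_def by (meson finite_subset)
  have "N \<subseteq> N'" if N': "nu_cand G F V N'" for N'
  proof -
    have "card N \<le> card (N \<inter> N')"
      by (rule min[OF nu_cand_inter[OF F VF(1) N N']])
    then have "N \<inter> N' = N"
      using \<open>finite N\<close> by (intro card_seteq) auto
    then show ?thesis by blast
  qed
  with N show ?thesis by blast
qed

text \<open>Antisymmetry of inclusion resolves the description operator in
  \<open>nu\<close>.\<close>

lemma nu_Suc_eqI:
  assumes "nu_cand Q (fitting Q) (nu Q i) N"
    and "\<And>N'. nu_cand Q (fitting Q) (nu Q i) N' \<Longrightarrow> N \<subseteq> N'"
  shows "nu Q (Suc i) = N"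
  unfolding nu.simps using assms by (intro the_equality) auto

text \<open>Well-definedness of the series. A least candidate exists below any term that is normal
  in the Fitting subgroup, and being a candidate includes this normality, so the induction carries
  itself.\<close>

lemma (in group) nu_normal_and_least:
  assumes fin: "finite (carrier G)"
  shows "nu G i \<lhd> G\<lparr>carrier := fitting G\<rparr>"
    and "nu_cand G (fitting G) (nu G i) (nu G (Suc i))"
    and "nu_cand G (fitting G) (nu G i) N \<Longrightarrow> nu G (Suc i) \<subseteq> N"
proof -
  note F = fitting_subgroup
  have step: "nu_cand G (fitting G) (nu G i) (nu G (Suc i)) \<and>
      (\<forall>N'. nu_cand G (fitting G) (nu G i) N' \<longrightarrow> nu G (Suc i) \<subseteq> N')"
    if nrm: "nu G i \<lhd> G\<lparr>carrier := fitting G\<rparr>" for i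
  proof -
    obtain N where N: "nu_cand G (fitting G) (nu G i) N"
        "\<And>N'. nu_cand G (fitting G) (nu G i) N' \<Longrightarrow> N \<subseteq> N'"
      using ex_least_nu_cand[OF fin F nrm] by blast
    with nu_Suc_eqI[OF N] show ?thesis by simp
  qed
  have nrm: "nu G i \<lhd> G\<lparr>carrier := fitting G\<rparr>" for i
  proof (induction i)
    case 0
    then show ?case
      using F subgroup.m_closed[OF F] subgroup.m_inv_closed[OF F]
      unfolding normal_in_subgroup_iff[OF F] by auto
  next
    case (Suc i)
    then show ?case
      using step[of i] by (simp only: nu_cand_def)
  qed
  show "nu G i \<lhd> G\<lparr>carrier := fitting G\<rparr>"
    by (rule nrm)
  show "nu_cand G (fitting G) (nu G i) (nu G (Suc i))"
    and "nu_cand G (fitting G) (nu G i) N \<Longrightarrow> nu G (Suc i) \<subseteq> N"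
    using step[OF nrm, of i] by blast+
qed

section \<open>Homomorphic images and preimages of candidates\<close>

lemma (in group_hom) nu_cand_image:
  assumes F: "subgroup F G" and V: "V \<subseteq> F" and N: "nu_cand G F V N"
  shows "nu_cand H (h ` F) (h ` V) (h ` N)"
proof -
  note hF = subgroup_img_is_subgroup[OF F]
  have N': "subgroup N G" "N \<subseteq> F" "N \<subseteq> V" "\<And>f x. f \<in> F \<Longrightarrow> x \<in> N \<Longrightarrow> f \<otimes>\<^bsub>G\<^esub> x \<otimes>\<^bsub>G\<^esub> inv\<^bsub>G\<^esub> f \<in> N"
    "\<And>f x. f \<in> F \<Longrightarrow> x \<in> V \<Longrightarrow> f \<otimes>\<^bsub>G\<^esub> x \<otimes>\<^bsub>G\<^esub> inv\<^bsub>G\<^esub> f \<otimes>\<^bsub>G\<^esub> inv\<^bsub>G\<^esub> x \<in> N"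
    "\<And>f x. f \<in> V \<Longrightarrow> x \<in> V \<Longrightarrow> f \<otimes>\<^bsub>G\<^esub> x \<otimes>\<^bsub>G\<^esub> inv\<^bsub>G\<^esub> f \<otimes>\<^bsub>G\<^esub> inv\<^bsub>G\<^esub> x \<in> N"
    "\<And>x. x \<in> V \<Longrightarrow> \<exists>m::nat. 0 < m \<and> squarefree m \<and> x [^]\<^bsub>G\<^esub> m \<in> N"
    using N unfolding nu_cand_def G.normal_in_subgroup_iff[OF F] by auto
  have F': "x \<in> carrier G" if "x \<in> F" for x
    using subgroup.mem_carrier[OF F that] .
  have V': "x \<in> carrier G" if "x \<in> V" for x
    using F' V that by auto
  have conj: "h f \<otimes>\<^bsub>H\<^esub> h x \<otimes>\<^bsub>H\<^esub> inv\<^bsub>H\<^esub> h f = h (f \<otimes>\<^bsub>G\<^esub> x \<otimes>\<^bsub>G\<^esub> inv\<^bsub>G\<^esub> f)"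
    and comm: "h f \<otimes>\<^bsub>H\<^esub> h x \<otimes>\<^bsub>H\<^esub> inv\<^bsub>H\<^esub> h f \<otimes>\<^bsub>H\<^esub> inv\<^bsub>H\<^esub> h x
      = h (f \<otimes>\<^bsub>G\<^esub> x \<otimes>\<^bsub>G\<^esub> inv\<^bsub>G\<^esub> f \<otimes>\<^bsub>G\<^esub> inv\<^bsub>G\<^esub> x)"
    if "f \<in> carrier G" "x \<in> carrier G" for f x
    using that by auto
  have pow: "\<exists>m::nat. 0 < m \<and> squarefree m \<and> h x [^]\<^bsub>H\<^esub> m \<in> h ` N" if "x \<in> V" for x
    using N'(7)[OF that] hom_nat_pow[OF V'[OF that]] by (metis imageI)
  show ?thesis
    unfolding nu_cand_def H.normal_in_subgroup_iff[OF hF]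
  proof (intro conjI ballI; (elim imageE)?; hypsubst?)
    show "subgroup (h ` N) H"
      by (rule subgroup_img_is_subgroup[OF N'(1)])
    show "h ` N \<subseteq> h ` F" "h ` N \<subseteq> h ` V"
      using N'(2,3) by auto
    show "h f \<otimes>\<^bsub>H\<^esub> h x \<otimes>\<^bsub>H\<^esub> inv\<^bsub>H\<^esub> h f \<in> h ` N" if "f \<in> F" "x \<in> N" for f x
      using that N'(2,4) by (subst conj) (blast intro: F')+
    show "h f \<otimes>\<^bsub>H\<^esub> h x \<otimes>\<^bsub>H\<^esub> inv\<^bsub>H\<^esub> h f \<otimes>\<^bsub>H\<^esub> inv\<^bsub>H\<^esub> h x \<in> h ` N" if "x \<in> V" "f \<in> F" for f x
      using that N'(5) by (subst comm) (blast intro: F' V')+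
    show "h f \<otimes>\<^bsub>H\<^esub> h x \<otimes>\<^bsub>H\<^esub> inv\<^bsub>H\<^esub> h f \<otimes>\<^bsub>H\<^esub> inv\<^bsub>H\<^esub> h x \<in> h ` N" if "f \<in> V" "x \<in> V" for f x
      using that N'(6) by (subst comm) (blast intro: V')+
    show "\<exists>m::nat. 0 < m \<and> squarefree m \<and> h x [^]\<^bsub>H\<^esub> m \<in> h ` N" if "x \<in> V" for x
      by (rule pow[OF that])
  qed
qed

text \<open>Supplies leastness in \<open>hom_nu\<close>. The preimage is cut down to
  \<open>V\<close> because a candidate has to lie in \<open>V\<close>.\<close>

lemma (in group_hom) nu_cand_preimage:
  assumes F: "subgroup F G" and V: "V \<lhd> G\<lparr>carrier := F\<rparr>"
    and N: "nu_cand H (h ` F) (h ` V) N"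
  shows "nu_cand G F V {x \<in> V. h x \<in> N}"
proof -
  note hF = subgroup_img_is_subgroup[OF F]
  have self: "nu_cand G F V V"
    by (rule G.nu_cand_self[OF F V])
  have V': "subgroup V G" "V \<subseteq> F" "\<And>f x. f \<in> F \<Longrightarrow> x \<in> V \<Longrightarrow> f \<otimes>\<^bsub>G\<^esub> x \<otimes>\<^bsub>G\<^esub> inv\<^bsub>G\<^esub> f \<in> V"
    "\<And>f x. f \<in> F \<Longrightarrow> x \<in> V \<Longrightarrow> f \<otimes>\<^bsub>G\<^esub> x \<otimes>\<^bsub>G\<^esub> inv\<^bsub>G\<^esub> f \<otimes>\<^bsub>G\<^esub> inv\<^bsub>G\<^esub> x \<in> V"
    using self unfolding nu_cand_def G.normal_in_subgroup_iff[OF F] by auto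
  have N': "subgroup N H" "\<And>f x. f \<in> F \<Longrightarrow> h x \<in> N \<Longrightarrow> h f \<otimes>\<^bsub>H\<^esub> h x \<otimes>\<^bsub>H\<^esub> inv\<^bsub>H\<^esub> h f \<in> N"
    "\<And>f x. f \<in> F \<Longrightarrow> x \<in> V \<Longrightarrow> h f \<otimes>\<^bsub>H\<^esub> h x \<otimes>\<^bsub>H\<^esub> inv\<^bsub>H\<^esub> h f \<otimes>\<^bsub>H\<^esub> inv\<^bsub>H\<^esub> h x \<in> N"
    "\<And>x. x \<in> V \<Longrightarrow> \<exists>m::nat. 0 < m \<and> squarefree m \<and> h x [^]\<^bsub>H\<^esub> m \<in> N"
    using N unfolding nu_cand_def H.normal_in_subgroup_iff[OF hF] by auto
  have F': "x \<in> carrier G" if "x \<in> F" for x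
    using subgroup.mem_carrier[OF F that] .
  have Vc: "x \<in> carrier G" if "x \<in> V" for x
    using F' V' that by auto
  have eq: "{x \<in> V. h x \<in> N} = V \<inter> {x \<in> carrier G. h x \<in> N}"
    using Vc by auto
  show ?thesis
    unfolding nu_cand_def G.normal_in_subgroup_iff[OF F]
  proof (intro conjI ballI)
    show "subgroup {x \<in> V. h x \<in> N} G"
      unfolding eq by (intro G.subgroups_Inter_pair V'(1) subgroup_preimage N'(1))
    show "f \<otimes>\<^bsub>G\<^esub> x \<otimes>\<^bsub>G\<^esub> inv\<^bsub>G\<^esub> f \<in> {x \<in> V. h x \<in> N}" if "f \<in> F" "x \<in> {x \<in> V. h x \<in> N}" for f x
      using that V'(3) N'(2) F' Vc by auto
    show comm: "f \<otimes>\<^bsub>G\<^esub> x \<otimes>\<^bsub>G\<^esub> inv\<^bsub>G\<^esub> f \<otimes>\<^bsub>G\<^esub> inv\<^bsub>G\<^esub> x \<in> {x \<in> V. h x \<in> N}" if "x \<in> V" "f \<in> F" for f x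
      using that V'(4) N'(3)[of f x] F' Vc by auto
    show "f \<otimes>\<^bsub>G\<^esub> x \<otimes>\<^bsub>G\<^esub> inv\<^bsub>G\<^esub> f \<otimes>\<^bsub>G\<^esub> inv\<^bsub>G\<^esub> x \<in> {x \<in> V. h x \<in> N}" if "f \<in> V" "x \<in> V" for f x
      using that V'(2) comm by blast
    show "\<exists>m::nat. 0 < m \<and> squarefree m \<and> x [^]\<^bsub>G\<^esub> m \<in> {x \<in> V. h x \<in> N}" if "x \<in> V" for x
      using N'(4)[OF that] that Vc G.subgroup_nat_pow_closed[OF V'(1)] hom_nat_pow by auto
  qed (use V' in auto)
qed

text \<open>Induction on the index. The image of the next term is a candidate by
  \<open>nu_cand_image\<close>; it lies in every candidate because the preimage of that candidate
  contains the next term of \<open>G\<close>.\<close>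

lemma (in group_hom) hom_nu:
  assumes fin: "finite (carrier G)" and fit: "h ` fitting G = fitting H"
  shows "h ` nu G i = nu H i"
proof (induction i)
  case 0
  then show ?case
    using fit by simp
next
  case (Suc i)
  note F = G.fitting_subgroup
  note nu = G.nu_normal_and_least[OF fin]
  have sub: "nu G i \<subseteq> fitting G"
    using nu(1)[of i] unfolding G.normal_in_subgroup_iff[OF F] by blast
  have "nu H (Suc i) = h ` nu G (Suc i)"
  proof (rule nu_Suc_eqI)
    show "nu_cand H (fitting H) (nu H i) (h ` nu G (Suc i))"
      using nu_cand_image[OF F sub nu(2)] fit Suc by simp
    fix N' assume "nu_cand H (fitting H) (nu H i) N'"
    then have "nu_cand G (fitting G) (nu G i) {x \<in> nu G i. h x \<in> N'}"
      by (intro nu_cand_preimage F nu(1)) (simp add: fit Suc)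
    from nu(3)[OF this] show "h ` nu G (Suc i) \<subseteq> N'"
      by blast
  qed
  then show ?case by simp
qed

section \<open>Lifting generators and finiteness\<close>

lemma (in group_hom) card_fibre_subgroup:
  assumes C: "subgroup C G" and "d \<in> h ` C"
  shows "card {x \<in> C. h x = d} = card {x \<in> C. h x = \<one>\<^bsub>H\<^esub>}"
proof -
  obtain c where c: "c \<in> C" "d = h c"
    using assms(2) by blast
  note mem = subgroup.mem_carrier[OF C] and closed = subgroup.m_closed[OF C] subgroup.m_inv_closed[OF C]
  \<comment> \<open>Left translation by a point \<open>c\<close> of the fibre identifies it with the
    fibre over the identity.\<close>
  have "bij_betw (\<lambda>x. c \<otimes>\<^bsub>G\<^esub> x) {x \<in> C. h x = \<one>\<^bsub>H\<^esub>} {x \<in> C. h x = d}"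
  proof (rule bij_betw_byWitness[where f' = "\<lambda>x. inv\<^bsub>G\<^esub> c \<otimes>\<^bsub>G\<^esub> x"])
    show "\<forall>x\<in>{x \<in> C. h x = \<one>\<^bsub>H\<^esub>}. inv\<^bsub>G\<^esub> c \<otimes>\<^bsub>G\<^esub> (c \<otimes>\<^bsub>G\<^esub> x) = x"
      using c mem by (simp add: G.inv_solve_left')
    show "\<forall>x\<in>{x \<in> C. h x = d}. c \<otimes>\<^bsub>G\<^esub> (inv\<^bsub>G\<^esub> c \<otimes>\<^bsub>G\<^esub> x) = x"
      using c mem by (simp flip: G.m_assoc)
    show "(\<lambda>x. c \<otimes>\<^bsub>G\<^esub> x) ` {x \<in> C. h x = \<one>\<^bsub>H\<^esub>} \<subseteq> {x \<in> C. h x = d}"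
      using c mem closed by auto
    show "(\<lambda>x. inv\<^bsub>G\<^esub> c \<otimes>\<^bsub>G\<^esub> x) ` {x \<in> C. h x = d} \<subseteq> {x \<in> C. h x = \<one>\<^bsub>H\<^esub>}"
      using c mem closed by auto
  qed
  then show ?thesis
    by (simp add: bij_betw_same_card)
qed

text \<open>
  Gaschuetz: all lifts of \<open>d\<close> to \<open>C\<close> are counted by the fibres of \<open>h\<close>, and each lift generates exactly
  one subgroup \<open>D\<close> of \<open>C\<close>, so induction on \<open>card C\<close> shows that the number of generating lifts
  does not depend on \<open>d\<close>.
\<close>

lemma (in group_hom) card_generating_lifts:
  fixes I :: "'i set"
  assumes fin: "finite (carrier G)" and I: "finite I" and C: "subgroup C G"
    and d: "generate H (d ` I) = h ` C" and e: "generate H (e ` I) = h ` C"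
  shows "card {y \<in> (\<Pi>\<^sub>E i\<in>I. {x \<in> C. h x = d i}). generate G (y ` I) = C}
       = card {y \<in> (\<Pi>\<^sub>E i\<in>I. {x \<in> C. h x = e i}). generate G (y ` I) = C}"
  using C d e
proof (induction "card C" arbitrary: C rule: less_induct)
  case less
  define lifts where "lifts D u = (\<Pi>\<^sub>E i\<in>I. {x \<in> D. h x = u i})" for D and u :: "'i \<Rightarrow> 'c"
  define gens where "gens D u = {y \<in> lifts D u. generate G (y ` I) = D}" for D and u :: "'i \<Rightarrow> 'c"
  define \<D> where "\<D> = {D. subgroup D G \<and> D \<subset> C}"
  have Cc: "C \<subseteq> carrier G"
    by (rule subgroup.subset[OF less.prems(1)])
  then have finC: "finite C"
    using fin finite_subset by blast
  have fin\<D>: "finite \<D>"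
    by (rule finite_subset[of _ "Pow C"]) (use finC in \<open>auto simp: \<D>_def\<close>)
  have fin_lifts: "finite (lifts C u)" for u
    unfolding lifts_def using finC I by (intro finite_PiE) auto
  have gens_lifts: "gens D u \<subseteq> lifts C u" if "D \<subseteq> C" for D u
    using that unfolding gens_def lifts_def by (fastforce simp: PiE_iff)
  have split: "lifts C u = gens C u \<union> (\<Union>D\<in>\<D>. gens D u)" for u
  proof
    show "lifts C u \<subseteq> gens C u \<union> (\<Union>D\<in>\<D>. gens D u)"
    proof
      fix y assume y: "y \<in> lifts C u"
      let ?D = "generate G (y ` I)"
      have sub: "y ` I \<subseteq> C"
        using y by (auto simp: lifts_def PiE_iff)
      then have "subgroup ?D G" "?D \<subseteq> C"
        using G.generate_is_subgroup[of "y ` I"] Cc G.generate_subgroup_incl[OF sub less.prems(1)] by auto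
      moreover have "y \<in> gens ?D u"
        using y unfolding gens_def lifts_def by (auto simp: PiE_iff intro: generate.incl)
      ultimately show "y \<in> gens C u \<union> (\<Union>D\<in>\<D>. gens D u)"
        unfolding \<D>_def by (cases "?D = C") auto
    qed
    show "gens C u \<union> (\<Union>D\<in>\<D>. gens D u) \<subseteq> lifts C u"
      using gens_lifts unfolding \<D>_def by blast
  qed
  have count: "card (lifts C u) = card (gens C u) + (\<Sum>D\<in>\<D>. card (gens D u))" for u
  proof -
    have "card (lifts C u) = card (gens C u) + card (\<Union>D\<in>\<D>. gens D u)"
      unfolding split[of u]
    proof (rule card_Un_disjoint)
      show "finite (gens C u)" "finite (\<Union>D\<in>\<D>. gens D u)"
        using fin_lifts[of u] unfolding split[of u] by simp_all
      show "gens C u \<inter> (\<Union>D\<in>\<D>. gens D u) = {}"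
        unfolding gens_def \<D>_def by auto
    qed
    also have "card (\<Union>D\<in>\<D>. gens D u) = (\<Sum>D\<in>\<D>. card (gens D u))"
    proof (rule card_UN_disjoint[OF fin\<D>])
      show "\<forall>D\<in>\<D>. finite (gens D u)"
        using gens_lifts[THEN finite_subset, OF _ fin_lifts[of u]] by (auto simp: \<D>_def)
      show "\<forall>D\<in>\<D>. \<forall>E\<in>\<D>. D \<noteq> E \<longrightarrow> gens D u \<inter> gens E u = {}"
        unfolding gens_def by auto
    qed
    finally show ?thesis .
  qed
  \<comment> \<open>The total is the same for every \<open>u\<close> generating the image of
    \<open>C\<close>: each \<open>u i\<close> lies in that image, so all fibres involved have the
    size of the one over the identity.\<close>
  have lifts_card: "card (lifts C u) = (\<Prod>i\<in>I. card {x \<in> C. h x = \<one>\<^bsub>H\<^esub>})"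
    if "generate H (u ` I) = h ` C" for u
  proof -
    have "u i \<in> h ` C" if "i \<in> I" for i
      using that \<open>generate H (u ` I) = h ` C\<close> generate.incl[of "u i" "u ` I" H] by auto
    then show ?thesis
      unfolding lifts_def using I card_fibre_subgroup[OF less.prems(1)]
      by (simp add: card_PiE)
  qed
  \<comment> \<open>A proper subgroup with full image is covered by the induction hypothesis. One
    with smaller image has no generating lift at all, since such a lift would force its image to be
    full.\<close>
  have "card (gens D d) = card (gens D e)" if D: "D \<in> \<D>" for D
  proof (cases "h ` D = h ` C")
    case True
    have "card D < card C"
      using D finC unfolding \<D>_def by (auto intro: psubset_card_mono)
    then show ?thesis
      using less.hyps[of D] D less.prems True unfolding gens_def lifts_def \<D>_def by simp
  next
    case False
    have "gens D u = {}" if u: "generate H (u ` I) = h ` C" for u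
    proof (rule equals0I)
      fix y assume y: "y \<in> gens D u"
      then have "h ` y ` I = u ` I" "y ` I \<subseteq> D" "generate G (y ` I) = D"
        unfolding gens_def lifts_def by (auto simp: PiE_iff image_iff)
      moreover have "D \<subseteq> carrier G"
        using D Cc unfolding \<D>_def by auto
      ultimately have "h ` D = h ` C"
        using generate_img[of "y ` I"] u by auto
      with False show False by simp
    qed
    then show ?thesis
      using less.prems by simp
  qed
  then have "(\<Sum>D\<in>\<D>. card (gens D d)) = (\<Sum>D\<in>\<D>. card (gens D e))"
    by simp
  \<comment> \<open>Equal totals minus equal contributions of the proper subgroups.\<close>
  then have "card (gens C d) = card (gens C e)"
    using count[of d] count[of e] lifts_card[OF less.prems(2)] lifts_card[OF less.prems(3)] by simp
  then show ?case
    unfolding gens_def lifts_def .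
qed

text \<open>Gaschuetz' lemma. The tuple \<open>y\<close> is a generating lift of its own image, so
  that image has a positive number of generating lifts, and by \<open>card_generating_lifts\<close>
  the number for \<open>d\<close> is the same.\<close>

lemma (in group_hom) lift_generators:
  fixes I :: "'i set"
  assumes fin: "finite (carrier G)" and I: "finite I" and surj: "h ` carrier G = carrier H"
    and y: "y ` I \<subseteq> carrier G" "generate G (y ` I) = carrier G"
    and d: "generate H (d ` I) = carrier H"
  obtains z where "\<And>i. i \<in> I \<Longrightarrow> z i \<in> carrier G" "\<And>i. i \<in> I \<Longrightarrow> h (z i) = d i"
    "generate G (z ` I) = carrier G"
proof -
  let ?lifts = "\<lambda>u. {y \<in> (\<Pi>\<^sub>E i\<in>I. {x \<in> carrier G. h x = u i}). generate G (y ` I) = carrier G}"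
  have "generate H ((h \<circ> y) ` I) = carrier H"
    using generate_img[OF y(1)] y(2) surj by (simp add: image_comp)
  then have "card (?lifts d) = card (?lifts (h \<circ> y))"
    using d surj by (intro card_generating_lifts[OF fin I G.subgroup_self]) auto
  moreover have "restrict y I \<in> ?lifts (h \<circ> y)"
    using y by (auto simp: restrict_def)
  \<comment> \<open>Infinite sets have cardinality 0, so finiteness is what turns a member into a
    positive count.\<close>
  moreover have "finite (?lifts (h \<circ> y))"
    by (rule finite_subset[OF _ finite_PiE[OF I, of "\<lambda>_. carrier G"]]) (use fin in \<open>auto simp: PiE_iff extensional_def\<close>)
  ultimately have "card (?lifts d) > 0"
    by (auto simp only: card_gt_0_iff)
  then have "?lifts d \<noteq> {}"
    by (auto simp only: card_gt_0_iff)
  then obtain z where "z \<in> ?lifts d"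
    by blast
  then show ?thesis
    by (intro that[of z]) (auto simp: PiE_iff)
qed

section \<open>Schreier's lemma and finiteness of extensions\<close>

lemma (in group_hom) kernel_finitely_generated:
  assumes S: "finite S" "S \<subseteq> carrier G" "generate G S = carrier G" and fin: "finite (carrier H)"
  obtains T where "finite T" "T \<subseteq> kernel G H h" "generate G T = kernel G H h"
proof -
  \<comment> \<open>A transversal of the kernel indexed by the image. The identity is represented by
    the identity, so that \<open>\<rho>\<close> below fixes the kernel pointwise.\<close>
  define t where "t b = (if b = \<one>\<^bsub>H\<^esub> then \<one>\<^bsub>G\<^esub> else SOME x. x \<in> carrier G \<and> h x = b)" for b
  have t: "t (h x) \<in> carrier G" "h (t (h x)) = h x" if "x \<in> carrier G" for x
    using someI[of "\<lambda>z. z \<in> carrier G \<and> h z = h x" x] that by (auto simp: t_def)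
  \<comment> \<open>Inverses are added so that every word in the generators is built by right
    multiplication with members of \<open>S'\<close> alone.\<close>
  define S' where "S' = S \<union> m_inv G ` S"
  have S': "finite S'" "S' \<subseteq> carrier G"
    using S by (auto simp: S'_def)
  \<comment> \<open>The Schreier generators: follow the representative of \<open>b\<close> by
    \<open>s\<close> and return along the representative of the coset reached.\<close>
  define sg where "sg b s = t b \<otimes>\<^bsub>G\<^esub> s \<otimes>\<^bsub>G\<^esub> inv\<^bsub>G\<^esub> t (h (t b \<otimes>\<^bsub>G\<^esub> s))" for b s
  define T where "T = (\<lambda>(b, s). sg b s) ` (h ` carrier G \<times> S')"
  have Tfin: "finite T"
    unfolding T_def using S' fin by (intro finite_imageI finite_cartesian_product finite_subset[OF _ fin]) auto
  have sg: "sg (h x) s \<in> kernel G H h" if "x \<in> carrier G" "s \<in> carrier G" for x s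
    using that t[OF that(1)] t[of "t (h x) \<otimes>\<^bsub>G\<^esub> s"] by (simp add: sg_def kernel_def H.r_inv)
  then have Tker: "T \<subseteq> kernel G H h"
    using S' unfolding T_def by auto
  then have Tc: "T \<subseteq> carrier G"
    by (auto simp: kernel_def)
  note sub = G.generate_is_subgroup[OF Tc]
  define \<rho> where "\<rho> x = x \<otimes>\<^bsub>G\<^esub> inv\<^bsub>G\<^esub> t (h x)" for x
  \<comment> \<open>The factor \<open>t (h y)\<close> cancels against its inverse, so right
    multiplication by \<open>s\<close> multiplies \<open>\<rho> y\<close> by a single Schreier
    generator.\<close>
  have step: "\<rho> (y \<otimes>\<^bsub>G\<^esub> s) \<in> generate G T" if y: "y \<in> carrier G" "\<rho> y \<in> generate G T" and s: "s \<in> S'" for y s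
  proof -
    have sc: "s \<in> carrier G"
      using s S' by auto
    have hs: "h (t (h y) \<otimes>\<^bsub>G\<^esub> s) = h (y \<otimes>\<^bsub>G\<^esub> s)"
      using t y sc by simp
    have tc: "t (h y) \<in> carrier G" "t (h (y \<otimes>\<^bsub>G\<^esub> s)) \<in> carrier G"
      using t y sc by (blast intro: G.m_closed)+
    have cancel: "inv\<^bsub>G\<^esub> a \<otimes>\<^bsub>G\<^esub> (a \<otimes>\<^bsub>G\<^esub> b) = b" if "a \<in> carrier G" "b \<in> carrier G" for a b
      using that by (simp flip: G.m_assoc)
    have "\<rho> (y \<otimes>\<^bsub>G\<^esub> s) = \<rho> y \<otimes>\<^bsub>G\<^esub> sg (h y) s"
      unfolding \<rho>_def sg_def hs using y sc tc
      by (simp add: G.m_assoc cancel del: hom_mult)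
    moreover have "sg (h y) s \<in> generate G T"
      using y s unfolding T_def by (intro generate.incl) auto
    ultimately show ?thesis
      using y subgroup.m_closed[OF sub] by simp
  qed
  \<comment> \<open>Stated for every starting point \<open>y\<close>, so that the product case can
    run the hypothesis for \<open>a\<close> at \<open>y\<close> and then the one for
    \<open>b\<close> at the product of \<open>y\<close> and \<open>a\<close>.\<close>
  have all: "\<rho> (y \<otimes>\<^bsub>G\<^esub> x) \<in> generate G T"
    if "x \<in> generate G S" "y \<in> carrier G" "\<rho> y \<in> generate G T" for x y
    using that
  proof (induction arbitrary: y rule: generate.induct)
    case one
    then show ?case by simp
  next
    case (incl s)
    then show ?case using step by (simp add: S'_def)
  next
    case (inv s)
    then show ?case using step by (simp add: S'_def)
  next
    case (eng a b)
    then have "a \<in> carrier G" "b \<in> carrier G"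
      using S by auto
    then show ?case
      using eng.IH(2)[of "y \<otimes>\<^bsub>G\<^esub> a"] eng.IH(1)[of y] eng.prems by (simp add: G.m_assoc)
  qed
  have "kernel G H h \<subseteq> generate G T"
  proof
    fix x assume "x \<in> kernel G H h"
    then have x: "x \<in> carrier G" "h x = \<one>\<^bsub>H\<^esub>"
      by (auto simp: kernel_def)
    have "\<rho> \<one>\<^bsub>G\<^esub> \<in> generate G T"
      by (simp add: \<rho>_def t_def generate.one)
    then have "\<rho> (\<one>\<^bsub>G\<^esub> \<otimes>\<^bsub>G\<^esub> x) \<in> generate G T"
      using all[of x "\<one>\<^bsub>G\<^esub>"] x S by auto
    then show "x \<in> generate G T"
      using x by (simp add: \<rho>_def t_def)
  qed
  moreover have "generate G T \<subseteq> kernel G H h"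
    by (rule G.generate_subgroup_incl[OF Tker subgroup_kernel])
  ultimately show ?thesis
    using that Tfin Tker by blast
qed

text \<open>Induction on the generators: the cyclic group of a new generator is finite, and the
  enlarged subgroup lies in the product of two finite subgroups.\<close>

lemma (in comm_group) finite_generate_of_exponent:
  fixes k :: nat
  assumes "finite T" "T \<subseteq> carrier G" "0 < k" "\<And>x. x \<in> carrier G \<Longrightarrow> x [^] k = \<one>"
  shows "finite (generate G T)"
  using assms(1,2)
proof (induction T)
  case empty
  then show ?case by (simp add: generate_empty)
next
  case (insert t T)
  then have t: "t \<in> carrier G" and T: "T \<subseteq> carrier G"
    by auto
  \<comment> \<open>Order 0 stands for infinite order, and 0 does not divide the positive
    \<open>k\<close>.\<close>
  have "ord t \<noteq> 0"
    using assms(3,4) t pow_eq_id[OF t, of k] by fastforce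
  then have fin: "finite (generate G {t})"
    using generate_pow_card[OF t] by (metis card.infinite)
  have sub: "subgroup (generate G T <#> generate G {t}) G"
    using t T by (intro mult_norm_subgroup subgroup_imp_normal generate_is_subgroup) auto
  have "x \<in> generate G T <#> generate G {t}" if "x \<in> insert t T" for x
  proof -
    have "x \<otimes> \<one> = x" "\<one> \<otimes> x = x"
      using that t T by auto
    then show ?thesis
      using that generate.one[of G "{t}"] generate.one[of G T]
        generate.incl[of x "{t}" G] generate.incl[of x T G]
      by (auto simp: set_mult_def) metis+
  qed
  then have "generate G (insert t T) \<subseteq> generate G T <#> generate G {t}"
    by (intro generate_subgroup_incl[OF _ sub]) auto
  moreover have "finite (generate G T <#> generate G {t})"
    using fin insert.IH[OF T] by (simp add: set_mult_def)
  ultimately show ?case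
    using finite_subset by blast
qed

text \<open>Each nonempty fibre is contained in a translate of the kernel, and there are finitely
  many fibres.\<close>

lemma (in group_hom) finite_carrier_of_finite_kernel:
  assumes "finite (carrier H)" "finite (kernel G H h)"
  shows "finite (carrier G)"
proof -
  have "finite (h -` {b} \<inter> carrier G)" for b
  proof (cases "h -` {b} \<inter> carrier G = {}")
    case False
    then obtain c where c: "c \<in> carrier G" "h c = b"
      by auto
    have "h -` {b} \<inter> carrier G \<subseteq> (\<lambda>z. c \<otimes>\<^bsub>G\<^esub> z) ` kernel G H h"
    proof
      fix x assume "x \<in> h -` {b} \<inter> carrier G"
      then have x: "x \<in> carrier G" "h x = b"
        by auto
      then have "x = c \<otimes>\<^bsub>G\<^esub> (inv\<^bsub>G\<^esub> c \<otimes>\<^bsub>G\<^esub> x)"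
        using c by (simp flip: G.m_assoc)
      moreover have "inv\<^bsub>G\<^esub> c \<otimes>\<^bsub>G\<^esub> x \<in> kernel G H h"
        using c x by (auto simp: kernel_def)
      ultimately show "x \<in> (\<lambda>z. c \<otimes>\<^bsub>G\<^esub> z) ` kernel G H h"
        by blast
    qed
    then show ?thesis
      using assms(2) finite_subset by blast
  qed simp
  then have "finite (h -` carrier H \<inter> carrier G)"
    by (rule finite_finite_vimage_IntI[OF assms(1)])
  moreover have "h -` carrier H \<inter> carrier G = carrier G"
    by auto
  ultimately show ?thesis
    by simp
qed

section \<open>The free group\<close>

abbreviation fcl :: "nat \<Rightarrow> fword \<Rightarrow> fword set" where
  "fcl n w \<equiv> free_eq n `` {w}"

lemma fwords_simps [simp]:
  "[] \<in> fwords n"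
  "x # w \<in> fwords n \<longleftrightarrow> fst x < n \<and> w \<in> fwords n"
  "v @ w \<in> fwords n \<longleftrightarrow> v \<in> fwords n \<and> w \<in> fwords n"
  by (auto simp: fwords_def)

text \<open>The closure is reflexive on all words, and a word outside \<open>fwords n\<close> is
  related only to itself; hence an equivalence on \<open>UNIV\<close>.\<close>

lemma equiv_free_eq: "equiv UNIV (free_eq n)"
proof (rule equivI)
  show "sym (free_eq n)"
    unfolding free_eq_def by (intro sym_rtrancl) (auto simp: sym_def)
qed (auto simp: free_eq_def refl_on_def intro: trans_rtrancl)

lemma fcl_eq_iff: "fcl n v = fcl n w \<longleftrightarrow> (v, w) \<in> free_eq n"
  by (simp add: eq_equiv_class_iff[OF equiv_free_eq])

lemma free_eq_fwords:
  assumes "(v, w) \<in> free_eq n" "v \<in> fwords n"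
  shows "w \<in> fwords n"
  using assms unfolding free_eq_def by (induction rule: rtrancl_induct) auto

lemma cancel1_context:
  assumes "(v, w) \<in> cancel1"
  shows "(a @ v @ b, a @ w @ b) \<in> cancel1"
proof -
  obtain p i c q where "v = p @ [(i, c), (i, \<not> c)] @ q" "w = p @ q"
    using assms unfolding cancel1_def by blast
  then have "a @ v @ b = (a @ p) @ [(i, c), (i, \<not> c)] @ (q @ b)" "a @ w @ b = (a @ p) @ (q @ b)"
    by simp_all
  then show ?thesis
    unfolding cancel1_def by blast
qed

text \<open>The congruence property behind multiplying classes by concatenating
  representatives.\<close>

lemma free_eq_context:
  assumes "(v, w) \<in> free_eq n" "a \<in> fwords n" "b \<in> fwords n"
  shows "(a @ v @ b, a @ w @ b) \<in> free_eq n"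
  using assms(1) unfolding free_eq_def
proof (induction rule: rtrancl_induct)
  case (step u w)
  then have "(a @ u @ b, a @ w @ b) \<in> (cancel1 \<union> cancel1\<inverse>) \<inter> (fwords n \<times> fwords n)"
    using assms(2,3) cancel1_context by auto
  with step.IH show ?case
    by (rule rtrancl_into_rtrancl)
qed simp

text \<open>Controls the representatives that the multiplication of \<open>free_group\<close> picks
  by choice.\<close>

lemma some_fcl:
  assumes "w \<in> fwords n"
  shows "(w, SOME x. x \<in> fcl n w) \<in> free_eq n" "(SOME x. x \<in> fcl n w) \<in> fwords n"
proof -
  have "w \<in> fcl n w"
    using equiv_free_eq[of n] by (simp add: equiv_def refl_on_def)
  then have "(SOME x. x \<in> fcl n w) \<in> fcl n w"
    by (rule someI)
  then show *: "(w, SOME x. x \<in> fcl n w) \<in> free_eq n"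
    by simp
  then show "(SOME x. x \<in> fcl n w) \<in> fwords n"
    using assms by (rule free_eq_fwords)
qed

lemma carrier_free_group: "carrier (free_group n) = fcl n ` fwords n"
  by (auto simp: free_group_def quotient_def)

lemma one_free_group: "\<one>\<^bsub>free_group n\<^esub> = fcl n []"
  by (simp add: free_group_def)

lemma mult_free_group:
  assumes "v \<in> fwords n" "w \<in> fwords n"
  shows "fcl n v \<otimes>\<^bsub>free_group n\<^esub> fcl n w = fcl n (v @ w)"
proof -
  let ?v = "SOME x. x \<in> fcl n v" and ?w = "SOME x. x \<in> fcl n w"
  have "(v @ w, ?v @ w) \<in> free_eq n"
    using free_eq_context[of v ?v n "[]" w] some_fcl[OF assms(1)] assms by simp
  moreover have "(?v @ w, ?v @ ?w) \<in> free_eq n"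
    using free_eq_context[of w ?w n ?v "[]"] some_fcl[OF assms(1)] some_fcl[OF assms(2)] by simp
  ultimately have "(v @ w, ?v @ ?w) \<in> free_eq n"
    unfolding free_eq_def by (rule rtrancl_trans)
  then show ?thesis
    by (simp add: free_group_def fcl_eq_iff[symmetric])
qed

lemma fcl_cancel:
  assumes "v \<in> fwords n" "w \<in> fwords n" "i < n"
  shows "fcl n (v @ (i, b) # (i, \<not> b) # w) = fcl n (v @ w)"
proof -
  have "(v @ (i, b) # (i, \<not> b) # w, v @ w) \<in> cancel1"
    unfolding cancel1_def by force
  then have "(v @ (i, b) # (i, \<not> b) # w, v @ w) \<in> free_eq n"
    unfolding free_eq_def using assms by (intro r_into_rtrancl) auto
  then show ?thesis
    unfolding fcl_eq_iff .
qed

lemma group_free_group: "group (free_group n)"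
proof (rule groupI)
  show "x \<otimes>\<^bsub>free_group n\<^esub> y \<in> carrier (free_group n)"
    if "x \<in> carrier (free_group n)" "y \<in> carrier (free_group n)" for x y
    using that by (auto simp: carrier_free_group mult_free_group)
  show "\<one>\<^bsub>free_group n\<^esub> \<in> carrier (free_group n)"
    by (auto simp: carrier_free_group one_free_group)
  show "x \<otimes>\<^bsub>free_group n\<^esub> y \<otimes>\<^bsub>free_group n\<^esub> z = x \<otimes>\<^bsub>free_group n\<^esub> (y \<otimes>\<^bsub>free_group n\<^esub> z)"
    if "x \<in> carrier (free_group n)" "y \<in> carrier (free_group n)" "z \<in> carrier (free_group n)" for x y z
    using that by (auto simp: carrier_free_group mult_free_group)
  show "\<one>\<^bsub>free_group n\<^esub> \<otimes>\<^bsub>free_group n\<^esub> x = x" if "x \<in> carrier (free_group n)" for x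
    using that by (auto simp: carrier_free_group mult_free_group one_free_group)
  show "\<exists>y\<in>carrier (free_group n). y \<otimes>\<^bsub>free_group n\<^esub> x = \<one>\<^bsub>free_group n\<^esub>"
    if "x \<in> carrier (free_group n)" for x
  proof -
    \<comment> \<open>Letters are removed from the front of \<open>w\<close>, so the inverse word
      grows at its end by the same letter with flipped sign.\<close>
    have "\<exists>v\<in>fwords n. fcl n (v @ w) = fcl n []" if "w \<in> fwords n" for w
      using that
    proof (induction w)
      case (Cons a w)
      obtain i b where a: "a = (i, b)"
        by (cases a)
      from Cons obtain v where v: "v \<in> fwords n" "fcl n (v @ w) = fcl n []"
        by auto
      then have "fcl n ((v @ [(i, \<not> b)]) @ a # w) = fcl n []"
        using fcl_cancel[of v n w i "\<not> b"] Cons.prems a by simp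
      then show ?case
        using v Cons.prems a by (intro bexI[of _ "v @ [(i, \<not> b)]"]) auto
    qed (auto intro: bexI[of _ "[]"])
    then show ?thesis
      using that by (force simp: carrier_free_group mult_free_group one_free_group)
  qed
qed

lemma free_gen_closed: "i < n \<Longrightarrow> free_gen n i \<in> carrier (free_group n)"
  by (auto simp: carrier_free_group free_gen_def)

lemma inv_free_gen:
  assumes "i < n"
  shows "inv\<^bsub>free_group n\<^esub> free_gen n i = fcl n [(i, False)]"
proof -
  interpret group "free_group n"
    by (rule group_free_group)
  have "fcl n [(i, False)] \<otimes>\<^bsub>free_group n\<^esub> free_gen n i = \<one>\<^bsub>free_group n\<^esub>"
    using fcl_cancel[of "[]" n "[]" i False] assms
    by (simp add: mult_free_group one_free_group free_gen_def)
  then show ?thesis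
    using assms by (intro inv_equality) (auto simp: carrier_free_group free_gen_def)
qed

lemma generate_free_gen: "generate (free_group n) (free_gen n ` {..<n}) = carrier (free_group n)"
proof
  interpret group "free_group n"
    by (rule group_free_group)
  show "generate (free_group n) (free_gen n ` {..<n}) \<subseteq> carrier (free_group n)"
    by (intro generate_incl) (auto intro: free_gen_closed)
  have "fcl n w \<in> generate (free_group n) (free_gen n ` {..<n})" if "w \<in> fwords n" for w
    using that
  proof (induction w)
    case Nil
    then show ?case
      by (metis generate.one one_free_group)
  next
    case (Cons a w)
    obtain i b where a: "a = (i, b)"
      by (cases a)
    have "fcl n [a] \<in> generate (free_group n) (free_gen n ` {..<n})"
      using generate.incl[of "free_gen n i" "free_gen n ` {..<n}" "free_group n"]
        generate.inv[of "free_gen n i" "free_gen n ` {..<n}" "free_group n"]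
        inv_free_gen[of i n] Cons.prems a
      by (cases b) (auto simp: free_gen_def)
    moreover have "fcl n (a # w) = fcl n [a] \<otimes>\<^bsub>free_group n\<^esub> fcl n w"
      using Cons.prems by (simp add: mult_free_group)
    ultimately show ?case
      using Cons by (auto intro: generate.eng)
  qed
  then show "carrier (free_group n) \<subseteq> generate (free_group n) (free_gen n ` {..<n})"
    by (auto simp: carrier_free_group)
qed

section \<open>Evaluation of words and the universal property\<close>

primrec word_eval :: "('a, 'b) monoid_scheme \<Rightarrow> (nat \<Rightarrow> 'a) \<Rightarrow> fword \<Rightarrow> 'a" where
  "word_eval H y [] = \<one>\<^bsub>H\<^esub>"
| "word_eval H y (x # w) = (if snd x then y (fst x) else inv\<^bsub>H\<^esub> y (fst x)) \<otimes>\<^bsub>H\<^esub> word_eval H y w"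

context group
begin

lemma word_eval_closed:
  assumes "\<And>i. i < n \<Longrightarrow> y i \<in> carrier G" "w \<in> fwords n"
  shows "word_eval G y w \<in> carrier G"
  using assms(2) by (induction w) (auto simp: assms(1))

lemma word_eval_append:
  assumes "\<And>i. i < n \<Longrightarrow> y i \<in> carrier G" "v \<in> fwords n" "w \<in> fwords n"
  shows "word_eval G y (v @ w) = word_eval G y v \<otimes> word_eval G y w"
  using assms(2,3) by (induction v) (auto simp: assms(1) word_eval_closed[OF assms(1)] m_assoc)

lemma word_eval_cancel1:
  assumes "\<And>i. i < n \<Longrightarrow> y i \<in> carrier G" "v \<in> fwords n" "(v, w) \<in> cancel1"
  shows "word_eval G y v = word_eval G y w"
proof -
  obtain p i c q where v: "v = p @ [(i, c), (i, \<not> c)] @ q" and w: "w = p @ q"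
    using assms(3) unfolding cancel1_def by blast
  have fw: "p \<in> fwords n" "q \<in> fwords n" "i < n"
    using assms(2) v by auto
  have "word_eval G y ([(i, c), (i, \<not> c)] @ q) = word_eval G y q"
    using assms(1)[OF fw(3)] word_eval_closed[OF assms(1) fw(2)]
    by (cases c) (simp_all flip: m_assoc)
  then show ?thesis
    using fw unfolding v w by (simp add: word_eval_append[OF assms(1)])
qed

lemma word_eval_free_eq:
  assumes "\<And>i. i < n \<Longrightarrow> y i \<in> carrier G" "(v, w) \<in> free_eq n"
  shows "word_eval G y v = word_eval G y w"
  using assms(2) unfolding free_eq_def
proof (induction rule: rtrancl_induct)
  case (step u w)
  then show ?case
    using word_eval_cancel1[OF assms(1), where n = n and v = u and w = w]
      word_eval_cancel1[OF assms(1), where n = n and v = w and w = u] by auto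
qed simp

text \<open>Evaluation is constant on classes, so evaluating a chosen representative is well
  defined, and it turns concatenation into multiplication.\<close>

lemma free_group_universal:
  assumes "\<And>i. i < n \<Longrightarrow> y i \<in> carrier G"
  obtains f where "f \<in> hom (free_group n) G" "\<And>i. i < n \<Longrightarrow> f (free_gen n i) = y i"
proof -
  define f where "f A = word_eval G y (SOME x. x \<in> A)" for A
  have f: "f (fcl n w) = word_eval G y w" if "w \<in> fwords n" for w
    unfolding f_def using word_eval_free_eq[OF assms some_fcl(1)[OF that]] by simp
  show ?thesis
  proof
    show "f \<in> hom (free_group n) G"
      by (rule homI)
        (auto simp: carrier_free_group f mult_free_group
          word_eval_append[OF assms] word_eval_closed[OF assms])
    show "f (free_gen n i) = y i" if "i < n" for i
      using that assms by (simp add: free_gen_def f)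
  qed
qed

end

lemma hom_eq_on_generators:
  assumes "group_hom G H f" "group_hom G H f'" "S \<subseteq> carrier G"
    and "\<And>s. s \<in> S \<Longrightarrow> f s = f' s" and "x \<in> generate G S"
  shows "f x = f' x"
proof -
  interpret f: group_hom G H f by fact
  interpret f': group_hom G H f' by fact
  show ?thesis
    using assms(5)
  proof (induction rule: generate.induct)
    case (eng a b)
    then show ?case
      using f.G.generate_in_carrier[OF assms(3)] by simp
  qed (use assms(3,4) in auto)
qed

section \<open>The covering group\<close>

lemma (in group) normal_comm_sub:
  assumes A: "A \<lhd> G" and B: "B \<lhd> G"
  shows "comm_sub G A B \<lhd> G"
  unfolding comm_sub_def
proof (rule normal_generateI)
  note mem = subgroup.mem_carrier[OF normal_imp_subgroup[OF A]] subgroup.mem_carrier[OF normal_imp_subgroup[OF B]]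
  let ?C = "{a \<otimes> b \<otimes> inv a \<otimes> inv b | a b. a \<in> A \<and> b \<in> B}"
  show "?C \<subseteq> carrier G"
    using mem by auto
  show "g \<otimes> x \<otimes> inv g \<in> ?C" if xC: "x \<in> ?C" and g: "g \<in> carrier G" for x g
  proof -
    obtain a b where x: "x = a \<otimes> b \<otimes> inv a \<otimes> inv b" and ab: "a \<in> A" "b \<in> B"
      using xC by blast
    \<comment> \<open>Conjugation by \<open>g\<close> respects products and inverses, so it takes a
      commutator of \<open>A\<close> and \<open>B\<close> to another one.\<close>
    define c where "c y = g \<otimes> y \<otimes> inv g" for y
    have mult: "c (y \<otimes> z) = c y \<otimes> c z" if "y \<in> carrier G" "z \<in> carrier G" for y z
    proof -
      have "inv g \<otimes> (g \<otimes> w) = w" if "w \<in> carrier G" for w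
        using that g by (simp flip: m_assoc)
      then show ?thesis
        using that g by (simp add: c_def m_assoc)
    qed
    have closed: "c y \<in> carrier G" if "y \<in> carrier G" for y
      using that g by (simp add: c_def)
    have inv: "c (inv y) = inv (c y)" if "y \<in> carrier G" for y
      using that g by (simp add: c_def inv_mult_group m_assoc)
    have "c x = c a \<otimes> c b \<otimes> inv (c a) \<otimes> inv (c b)"
      using mem ab by (simp add: x mult inv)
    moreover have "c a \<in> A" "c b \<in> B"
      using normal_invE(2)[OF A g] normal_invE(2)[OF B g] ab by (auto simp: c_def)
    ultimately show ?thesis
      unfolding c_def[of x] by blast
  qed
qed

lemma (in group) normal_generate_powers:
  fixes k :: nat
  assumes A: "A \<lhd> G"
  shows "generate G {a [^] k | a. a \<in> A} \<lhd> G"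
proof (rule normal_generateI)
  note mem = subgroup.mem_carrier[OF normal_imp_subgroup[OF A]]
  show "{a [^] k | a. a \<in> A} \<subseteq> carrier G"
    using mem by auto
  show "g \<otimes> x \<otimes> inv g \<in> {a [^] k | a. a \<in> A}" if xC: "x \<in> {a [^] k | a. a \<in> A}" and g: "g \<in> carrier G" for x g
  proof -
    obtain a where x: "x = a [^] k" and a: "a \<in> A"
      using xC by blast
    have ac: "a \<in> carrier G"
      using mem a by simp
    have cancel: "inv g \<otimes> (g \<otimes> w) = w" if "w \<in> carrier G" for w
      using that g by (simp flip: m_assoc)
    have "g \<otimes> a [^] m \<otimes> inv g = (g \<otimes> a \<otimes> inv g) [^] m" for m :: nat
    proof (induction m)
      case (Suc m)
      have "(g \<otimes> a \<otimes> inv g) [^] Suc m = g \<otimes> a [^] m \<otimes> inv g \<otimes> (g \<otimes> a \<otimes> inv g)"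
        by (simp add: Suc)
      also have "\<dots> = g \<otimes> a [^] Suc m \<otimes> inv g"
        using ac g by (simp add: m_assoc cancel)
      finally show ?case by simp
    qed (use g in simp)
    then show ?thesis
      using normal_invE(2)[OF A g a] x by blast
  qed
qed

lemma (in group) normal_set_mult:
  assumes A: "A \<lhd> G" and B: "B \<lhd> G"
  shows "A <#> B \<lhd> G"
proof (rule normal_invI)
  note mem = subgroup.mem_carrier[OF normal_imp_subgroup[OF A]] subgroup.mem_carrier[OF normal_imp_subgroup[OF B]]
  show "subgroup (A <#> B) G"
    by (rule mult_norm_subgroup[OF A normal_imp_subgroup[OF B]])
  fix g x assume g: "g \<in> carrier G" and "x \<in> A <#> B"
  then obtain a b where x: "x = a \<otimes> b" and ab: "a \<in> A" "b \<in> B"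
    by (auto simp: set_mult_def)
  have "inv g \<otimes> (g \<otimes> w) = w" if "w \<in> carrier G" for w
    using that g by (simp flip: m_assoc)
  then have "g \<otimes> x \<otimes> inv g = (g \<otimes> a \<otimes> inv g) \<otimes> (g \<otimes> b \<otimes> inv g)"
    using g ab mem by (simp add: x m_assoc)
  then show "g \<otimes> x \<otimes> inv g \<in> A <#> B"
    using normal_invE(2)[OF A g ab(1)] normal_invE(2)[OF B g ab(2)] by (auto simp: set_mult_def)
qed

lemma (in normal) Mod_hom: "group_hom G (G Mod H) (\<lambda>x. H #> x)"
  by (intro group_hom.intro group_hom_axioms.intro is_group factorgroup_is_group r_coset_hom_Mod)

lemma (in normal) Mod_kernel: "kernel G (G Mod H) (\<lambda>x. H #> x) = H"
  using coset_join1[OF _ _ subgroup_axioms] coset_join2[OF _ subgroup_axioms] mem_carrier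
  by (auto simp: kernel_def)

text \<open>A subgroup containing the kernel is a union of fibres. This pulls membership back from a
  quotient.\<close>

lemma (in group_hom) mem_of_image_mem:
  assumes S: "subgroup S G" "kernel G H h \<subseteq> S" and x: "x \<in> carrier G" "h x \<in> h ` S"
  shows "x \<in> S"
proof -
  obtain s where s: "s \<in> S" "h x = h s"
    using x(2) by blast
  have sc: "s \<in> carrier G"
    using subgroup.mem_carrier[OF S(1) s(1)] .
  have "x \<otimes>\<^bsub>G\<^esub> inv\<^bsub>G\<^esub> s \<in> S"
    using S(2) x(1) sc s(2) by (auto simp: kernel_def)
  then have "x \<otimes>\<^bsub>G\<^esub> inv\<^bsub>G\<^esub> s \<otimes>\<^bsub>G\<^esub> s \<in> S"
    using s(1) subgroup.m_closed[OF S(1)] by blast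
  then show ?thesis
    using x(1) sc by (simp add: G.m_assoc)
qed

section \<open>The covering group between the free group and \<open>G\<close>\<close>

locale covering =
  fixes G :: "('a, 'b) monoid_scheme" and n :: nat and \<mu> :: "fword set \<Rightarrow> 'a"
  assumes group_G: "group G" and finite_G: "finite (carrier G)"
    and mu_hom: "\<mu> \<in> hom (free_group n) G"
    and mu_surj: "\<mu> ` carrier (free_group n) = carrier G"
begin

abbreviation "F \<equiv> free_group n"
abbreviation "R \<equiv> cov_R G n \<mu>"
abbreviation "L \<equiv> cov_L G n \<mu>"
abbreviation "K \<equiv> cov_K G n \<mu>"
abbreviation "Q \<equiv> cover_group G n \<mu>"
abbreviation "M \<equiv> cov_M G n \<mu>"
abbreviation "k \<equiv> cov_k G"

definition q :: "fword set \<Rightarrow> fword set set" where "q x = K #>\<^bsub>F\<^esub> x"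

sublocale F: group F
  by (rule group_free_group)

sublocale G: group G
  by (rule group_G)

sublocale mu: group_hom F G \<mu>
  using mu_hom by unfold_locales

lemma k_pos: "0 < k"
  unfolding cov_k_def by (intro prod_pos) (auto dest: in_prime_factors_imp_prime prime_gt_0_nat)

lemma R_normal: "R \<lhd> F"
  unfolding cov_R_def by (rule mu.normal_kernel)

lemma L_normal: "L \<lhd> F"
  unfolding cov_L_def by (rule mu.normal_preimage[OF G.fitting_normal])

lemma R_carrier: "r \<in> R \<Longrightarrow> r \<in> carrier F" and L_carrier: "l \<in> L \<Longrightarrow> l \<in> carrier F"
  by (auto simp: cov_R_def cov_L_def kernel_def)

lemma K_normal: "K \<lhd> F"
  unfolding cov_K_def
  by (intro F.normal_set_mult F.normal_comm_sub F.normal_generate_powers R_normal L_normal)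

text \<open>\<open>K\<close> is the product of the subgroups generated by these commutators and by
  these powers. The test is applied to \<open>R\<close> and later to the kernel of a lifted
  homomorphism.\<close>

lemma K_subsetI:
  assumes S: "subgroup S F"
    and "\<And>r l. r \<in> R \<Longrightarrow> l \<in> L \<Longrightarrow> r \<otimes>\<^bsub>F\<^esub> l \<otimes>\<^bsub>F\<^esub> inv\<^bsub>F\<^esub> r \<otimes>\<^bsub>F\<^esub> inv\<^bsub>F\<^esub> l \<in> S"
    and "\<And>r. r \<in> R \<Longrightarrow> r [^]\<^bsub>F\<^esub> k \<in> S"
  shows "K \<subseteq> S"
proof -
  have "comm_sub F R L \<subseteq> S"
    unfolding comm_sub_def using assms(2) by (intro F.generate_subgroup_incl[OF _ S]) auto
  moreover have "generate F {r [^]\<^bsub>F\<^esub> k | r. r \<in> R} \<subseteq> S"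
    using assms(3) by (intro F.generate_subgroup_incl[OF _ S]) auto
  ultimately show ?thesis
    unfolding cov_K_def using subgroup.m_closed[OF S] by (auto simp: set_mult_def)
qed

lemma comm_in_K:
  assumes "r \<in> R" "l \<in> L"
  shows "r \<otimes>\<^bsub>F\<^esub> l \<otimes>\<^bsub>F\<^esub> inv\<^bsub>F\<^esub> r \<otimes>\<^bsub>F\<^esub> inv\<^bsub>F\<^esub> l \<in> K"
proof -
  let ?c = "r \<otimes>\<^bsub>F\<^esub> l \<otimes>\<^bsub>F\<^esub> inv\<^bsub>F\<^esub> r \<otimes>\<^bsub>F\<^esub> inv\<^bsub>F\<^esub> l"
  have "?c \<in> comm_sub F R L"
    unfolding comm_sub_def using assms by (intro generate.incl) blast
  moreover have "?c = ?c \<otimes>\<^bsub>F\<^esub> \<one>\<^bsub>F\<^esub>"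
    using assms R_carrier L_carrier by simp
  ultimately show ?thesis
    unfolding cov_K_def set_mult_def using generate.one by fast
qed

lemma pow_in_K:
  assumes "r \<in> R"
  shows "r [^]\<^bsub>F\<^esub> k \<in> K"
proof -
  have "r [^]\<^bsub>F\<^esub> k \<in> generate F {r [^]\<^bsub>F\<^esub> k | r. r \<in> R}"
    using assms by (intro generate.incl) blast
  moreover have "r [^]\<^bsub>F\<^esub> k = \<one>\<^bsub>F\<^esub> \<otimes>\<^bsub>F\<^esub> r [^]\<^bsub>F\<^esub> k"
    using assms R_carrier by simp
  moreover have "\<one>\<^bsub>F\<^esub> \<in> comm_sub F R L"
    by (simp add: comm_sub_def generate.one)
  ultimately show ?thesis
    unfolding cov_K_def set_mult_def by blast
qed

lemma K_subset_R: "K \<subseteq> R"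
proof (rule K_subsetI)
  note R = normal_imp_subgroup[OF R_normal]
  show "subgroup R F"
    by (rule R)
  show "r [^]\<^bsub>F\<^esub> k \<in> R" if "r \<in> R" for r
    by (rule F.subgroup_nat_pow_closed[OF R that])
  show "r \<otimes>\<^bsub>F\<^esub> l \<otimes>\<^bsub>F\<^esub> inv\<^bsub>F\<^esub> r \<otimes>\<^bsub>F\<^esub> inv\<^bsub>F\<^esub> l \<in> R" if "r \<in> R" "l \<in> L" for r l
  proof -
    \<comment> \<open>The commutator of \<open>r\<close> and \<open>l\<close> is \<open>r\<close>
      times a conjugate of its inverse, and \<open>R\<close> is normal.\<close>
    have "l \<otimes>\<^bsub>F\<^esub> inv\<^bsub>F\<^esub> r \<otimes>\<^bsub>F\<^esub> inv\<^bsub>F\<^esub> l \<in> R"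
      using that L_carrier F.normal_invE(2)[OF R_normal] subgroup.m_inv_closed[OF R] by blast
    then have "r \<otimes>\<^bsub>F\<^esub> (l \<otimes>\<^bsub>F\<^esub> inv\<^bsub>F\<^esub> r \<otimes>\<^bsub>F\<^esub> inv\<^bsub>F\<^esub> l) \<in> R"
      using that subgroup.m_closed[OF R] by blast
    then show ?thesis
      using that R_carrier L_carrier by (simp add: F.m_assoc)
  qed
qed

sublocale q: group_hom F Q q
  using normal.Mod_hom[OF K_normal] unfolding q_def[abs_def] cover_group_def .

lemma q_surj: "q ` carrier F = carrier Q"
  by (simp add: q_def[abs_def] cover_group_def carrier_FactGroup)

lemma q_kernel: "kernel F Q q = K"
  using normal.Mod_kernel[OF K_normal] unfolding q_def[abs_def] cover_group_def .

lemma M_eq: "M = q ` R"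
  by (simp add: cov_M_def q_def[abs_def])

lemma M_carrier: "M \<subseteq> carrier Q"
  using R_carrier by (auto simp: M_eq)

lemma generate_q: "generate Q ((\<lambda>i. q (free_gen n i)) ` {..<n}) = carrier Q"
proof -
  have "generate Q (q ` free_gen n ` {..<n}) = q ` carrier F"
    using q.generate_img[of "free_gen n ` {..<n}"] free_gen_closed generate_free_gen[of n] by auto
  then show ?thesis
    by (simp add: image_image q_surj)
qed

text \<open>The epimorphism from the covering group to \<open>G\<close> induced by
  \<open>\<mu>\<close>; its existence rests on \<open>K_subset_R\<close>. The choice makes it a
  constant of the locale.\<close>

definition pr :: "fword set set \<Rightarrow> 'a" where
  "pr = (SOME p. p \<in> hom Q G \<and> (\<forall>x\<in>carrier F. p (q x) = \<mu> x))"

lemma pr_hom: "pr \<in> hom Q G" and pr_q: "x \<in> carrier F \<Longrightarrow> pr (q x) = \<mu> x"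
proof -
  obtain p where "p \<in> hom (F Mod K) G" "\<And>x. x \<in> carrier F \<Longrightarrow> p (K #>\<^bsub>F\<^esub> x) = \<mu> x"
    using mu.FactGroup_universal_kernel[OF K_normal] K_subset_R unfolding cov_R_def by blast
  then have "\<exists>p. p \<in> hom Q G \<and> (\<forall>x\<in>carrier F. p (q x) = \<mu> x)"
    by (auto simp: cover_group_def q_def)
  then have "pr \<in> hom Q G \<and> (\<forall>x\<in>carrier F. pr (q x) = \<mu> x)"
    unfolding pr_def by (rule someI_ex)
  then show "pr \<in> hom Q G" "x \<in> carrier F \<Longrightarrow> pr (q x) = \<mu> x"
    by auto
qed

sublocale pr: group_hom Q G pr
  using pr_hom by unfold_locales

lemma pr_surj: "pr ` carrier Q = carrier G"
proof -
  have "pr ` q ` carrier F = \<mu> ` carrier F"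
    by (simp add: image_image pr_q cong: image_cong)
  then show ?thesis
    by (simp only: q_surj mu_surj)
qed

lemma pr_kernel: "kernel Q G pr = M"
proof -
  have "kernel Q G pr = {x \<in> q ` carrier F. pr x = \<one>\<^bsub>G\<^esub>}"
    by (simp only: kernel_def q_surj)
  also have "\<dots> = q ` R"
    by (auto simp: cov_R_def kernel_def pr_q)
  finally show ?thesis
    by (simp only: M_eq)
qed

lemma M_normal: "M \<lhd> Q"
  using pr.normal_kernel by (simp add: pr_kernel)

text \<open>Elements over \<open>fitting G\<close> are the classes of members of \<open>L\<close>,
  and commutators of \<open>R\<close> with \<open>L\<close> become trivial modulo
  \<open>K\<close>.\<close>

lemma M_central:
  assumes "z \<in> M" "x \<in> carrier Q" "pr x \<in> fitting G"
  shows "z \<otimes>\<^bsub>Q\<^esub> x = x \<otimes>\<^bsub>Q\<^esub> z"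
proof -
  obtain r where r: "r \<in> R" "z = q r"
    using assms(1) by (auto simp: M_eq)
  obtain l where l: "l \<in> carrier F" "x = q l"
    using assms(2) q_surj by blast
  then have "l \<in> L"
    using assms(3) by (simp add: cov_L_def pr_q)
  then have "q (r \<otimes>\<^bsub>F\<^esub> l \<otimes>\<^bsub>F\<^esub> inv\<^bsub>F\<^esub> r \<otimes>\<^bsub>F\<^esub> inv\<^bsub>F\<^esub> l) = \<one>\<^bsub>Q\<^esub>"
    using comm_in_K[OF r(1)] by (simp add: kernel_def flip: q_kernel)
  then have eq: "z \<otimes>\<^bsub>Q\<^esub> x \<otimes>\<^bsub>Q\<^esub> inv\<^bsub>Q\<^esub> z \<otimes>\<^bsub>Q\<^esub> inv\<^bsub>Q\<^esub> x = \<one>\<^bsub>Q\<^esub>"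
    using R_carrier[OF r(1)] l r by simp
  have zx: "z \<in> carrier Q" "x \<in> carrier Q"
    using assms M_carrier by auto
  then have "z \<otimes>\<^bsub>Q\<^esub> x \<otimes>\<^bsub>Q\<^esub> inv\<^bsub>Q\<^esub> (x \<otimes>\<^bsub>Q\<^esub> z) = \<one>\<^bsub>Q\<^esub>"
    using eq by (simp add: q.H.inv_mult_group q.H.m_assoc)
  then show ?thesis
    using zx by (metis q.H.inv_closed q.H.inv_equality q.H.inv_inv q.H.m_closed)
qed

lemma M_exponent:
  assumes "z \<in> M"
  shows "z [^]\<^bsub>Q\<^esub> k = \<one>\<^bsub>Q\<^esub>"
proof -
  obtain r where r: "r \<in> R" "z = q r"
    using assms by (auto simp: M_eq)
  then have "q (r [^]\<^bsub>F\<^esub> k) = \<one>\<^bsub>Q\<^esub>"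
    using pow_in_K[OF r(1)] by (simp add: kernel_def flip: q_kernel)
  then show ?thesis
    using r R_carrier q.hom_nat_pow by simp
qed

text \<open>\<open>M\<close> maps to the identity, so \<open>M_central\<close> applies to pairs from
  \<open>M\<close> and shows that \<open>M\<close> is commutative.\<close>

lemma M_fitting: "z \<in> M \<Longrightarrow> pr z \<in> fitting G"
  using subgroup.one_closed[OF G.fitting_subgroup] unfolding pr_kernel[symmetric] kernel_def by simp

text \<open>\<open>M\<close> is the kernel of \<open>pr\<close> and commutes with everything over
  \<open>fitting G\<close>, so this is a case of \<open>fitting_central_extension\<close>.\<close>

lemma fitting_cover: "fitting Q = {x \<in> carrier Q. pr x \<in> fitting G}"
  using M_central by (intro pr.fitting_central_extension pr_surj) (simp add: pr_kernel)

text \<open>By Schreier's lemma \<open>M\<close> is finitely generated; it is commutative of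
  exponent dividing \<open>k\<close>, hence finite, and it is the kernel of a map to the finite
  group \<open>G\<close>.\<close>

lemma finite_cover: "finite (carrier Q)"
proof -
  let ?S = "(\<lambda>i. q (free_gen n i)) ` {..<n}"
  have "?S \<subseteq> carrier Q"
    using free_gen_closed by auto
  then obtain T where T: "finite T" "T \<subseteq> M" "generate Q T = M"
    using pr.kernel_finitely_generated[of ?S] generate_q finite_G unfolding pr_kernel by blast
  let ?M = "Q\<lparr>carrier := M\<rparr>"
  note M = normal_imp_subgroup[OF M_normal]
  have "comm_group ?M"
    using M_central M_fitting M_carrier
    by (intro group.group_comm_groupI q.H.subgroup_imp_group[OF M]) auto
  then have "finite (generate ?M T)"
    using T(1,2) k_pos M_exponent
    by (intro comm_group.finite_generate_of_exponent[where k = k]) (auto simp flip: q.H.nat_pow_consistent)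
  then have "finite M"
    using q.H.generate_consistent[OF T(2) M] T(3) by simp
  then show ?thesis
    using pr.finite_carrier_of_finite_kernel finite_G pr_kernel by simp
qed

section \<open>Quotients of the covering group by subgroups of \<open>M\<close>\<close>

lemma fitting_quotient:
  assumes U: "U \<lhd> Q" "U \<subseteq> M"
  shows "fitting (Q Mod U) = (\<lambda>x. U #>\<^bsub>Q\<^esub> x) ` fitting Q"
proof -
  let ?\<sigma> = "\<lambda>x. U #>\<^bsub>Q\<^esub> x"
  interpret \<sigma>: group_hom Q "Q Mod U" ?\<sigma>
    by (rule normal.Mod_hom[OF U(1)])
  \<comment> \<open>Since \<open>U\<close> lies in \<open>M\<close>, \<open>pr\<close> factors
    through \<open>Q Mod U\<close>. The kernel of \<open>\<tau>\<close> is the image of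
    \<open>M\<close> and inherits its commutation property, so both Fitting subgroups are preimages
    of \<open>fitting G\<close>.\<close>
  obtain \<tau> where \<tau>: "\<tau> \<in> hom (Q Mod U) G" "\<And>x. x \<in> carrier Q \<Longrightarrow> \<tau> (?\<sigma> x) = pr x"
    using pr.FactGroup_universal_kernel[OF U(1)] U(2) pr_kernel by metis
  interpret \<tau>: group_hom "Q Mod U" G \<tau>
    using \<tau>(1) by unfold_locales
  have carrier: "carrier (Q Mod U) = ?\<sigma> ` carrier Q"
    by (rule carrier_FactGroup)
  have "fitting (Q Mod U) = {x \<in> carrier (Q Mod U). \<tau> x \<in> fitting G}"
  proof (rule \<tau>.fitting_central_extension)
    show "\<tau> ` carrier (Q Mod U) = carrier G"
      unfolding carrier image_image pr_surj[symmetric] by (rule image_cong) (auto simp: \<tau>(2))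
    fix z x assume "z \<in> kernel (Q Mod U) G \<tau>" "x \<in> carrier (Q Mod U)" and fit: "\<tau> x \<in> fitting G"
    then obtain z' x' where z': "z' \<in> carrier Q" "z = ?\<sigma> z'" "\<tau> z = \<one>\<^bsub>G\<^esub>"
      and x': "x' \<in> carrier Q" "x = ?\<sigma> x'"
      unfolding kernel_def carrier by blast
    then have "z' \<in> M"
      unfolding pr_kernel[symmetric] kernel_def by (simp add: \<tau>(2))
    then have "z' \<otimes>\<^bsub>Q\<^esub> x' = x' \<otimes>\<^bsub>Q\<^esub> z'"
      using M_central x' fit \<tau>(2) by simp
    then have "?\<sigma> (z' \<otimes>\<^bsub>Q\<^esub> x') = ?\<sigma> (x' \<otimes>\<^bsub>Q\<^esub> z')"
      by simp
    then show "z \<otimes>\<^bsub>Q Mod U\<^esub> x = x \<otimes>\<^bsub>Q Mod U\<^esub> z"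
      using z' x' \<sigma>.hom_mult by metis
  qed
  also have "\<dots> = ?\<sigma> ` fitting Q"
    unfolding fitting_cover carrier using \<tau>(2) by auto
  finally show ?thesis .
qed

text \<open>The term \<open>nu Q c\<close> maps onto the corresponding term of the quotient and has
  the same image as \<open>M\<close>, as \<open>U\<close> becomes trivial. Thus the image of
  \<open>M\<close> is determined by the quotient as an abstract group.\<close>

lemma nu_quotient:
  assumes U: "U \<lhd> Q" "U \<subseteq> M" and M: "M = nu Q c <#>\<^bsub>Q\<^esub> U"
  shows "nu (Q Mod U) c = (\<lambda>x. U #>\<^bsub>Q\<^esub> x) ` M"
proof -
  let ?\<sigma> = "\<lambda>x. U #>\<^bsub>Q\<^esub> x"
  interpret \<sigma>: group_hom Q "Q Mod U" ?\<sigma>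
    by (rule normal.Mod_hom[OF U(1)])
  note Usub = normal_imp_subgroup[OF U(1)]
  have "nu Q c \<lhd> Q\<lparr>carrier := fitting Q\<rparr>"
    by (rule q.H.nu_normal_and_least(1)[OF finite_cover])
  then have nu: "x \<in> carrier Q" if "x \<in> nu Q c" for x
    using that unfolding q.H.normal_in_subgroup_iff[OF q.H.fitting_subgroup]
    by (auto dest: subgroup.mem_carrier)
  have \<sigma>U: "?\<sigma> u = \<one>\<^bsub>Q Mod U\<^esub>" "u \<in> carrier Q" if "u \<in> U" for u
    using that normal.Mod_kernel[OF U(1)] unfolding kernel_def by blast+
  have "?\<sigma> (a \<otimes>\<^bsub>Q\<^esub> u) = ?\<sigma> a" if "a \<in> nu Q c" "u \<in> U" for a u
    using \<sigma>.hom_mult[OF nu[OF that(1)] \<sigma>U(2)[OF that(2)]] \<sigma>U(1)[OF that(2)]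
      \<sigma>.H.r_one[OF \<sigma>.hom_closed[OF nu[OF that(1)]]] by simp
  then have "?\<sigma> ` M \<subseteq> ?\<sigma> ` nu Q c"
    unfolding M set_mult_def by auto
  moreover have "nu Q c \<subseteq> M"
  proof
    fix a assume "a \<in> nu Q c"
    then have "a \<otimes>\<^bsub>Q\<^esub> \<one>\<^bsub>Q\<^esub> \<in> nu Q c <#>\<^bsub>Q\<^esub> U"
      using subgroup.one_closed[OF Usub] unfolding set_mult_def by blast
    then show "a \<in> M"
      using nu[OF \<open>a \<in> nu Q c\<close>] M by simp
  qed
  ultimately have "?\<sigma> ` M = ?\<sigma> ` nu Q c"
    by blast
  then show ?thesis
    using \<sigma>.hom_nu[OF finite_cover fitting_quotient[OF U, symmetric]] by simp
qed

text \<open>The lift makes the square with \<open>\<phi>\<close> and the two projections commute.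
  Since \<open>U\<close> and \<open>V\<close> are the kernels of the projections, this forces
  \<open>U\<close> to be carried onto \<open>V\<close>.\<close>

lemma iso_quotients_lift:
  assumes U: "U \<lhd> Q" "U \<subseteq> M" "M = nu Q c <#>\<^bsub>Q\<^esub> U"
    and V: "V \<lhd> Q" "V \<subseteq> M" "M = nu Q c <#>\<^bsub>Q\<^esub> V"
    and \<phi>: "\<phi> \<in> iso (Q Mod U) (Q Mod V)"
  obtains \<alpha> where "\<alpha> \<in> iso Q Q" "\<alpha> ` M = M" "\<alpha> ` U = V"
proof -
  let ?\<sigma> = "\<lambda>x. U #>\<^bsub>Q\<^esub> x" and ?\<tau> = "\<lambda>x. V #>\<^bsub>Q\<^esub> x"
  let ?gen = "free_gen n"
  interpret \<sigma>: group_hom Q "Q Mod U" ?\<sigma>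
    by (rule normal.Mod_hom[OF U(1)])
  interpret \<tau>: group_hom Q "Q Mod V" ?\<tau>
    by (rule normal.Mod_hom[OF V(1)])
  have \<sigma>_ker: "kernel Q (Q Mod U) ?\<sigma> = U" and \<tau>_ker: "kernel Q (Q Mod V) ?\<tau> = V"
    by (rule normal.Mod_kernel[OF U(1)] normal.Mod_kernel[OF V(1)])+
  have \<sigma>_surj: "?\<sigma> ` carrier Q = carrier (Q Mod U)" and \<tau>_surj: "?\<tau> ` carrier Q = carrier (Q Mod V)"
    by (simp_all add: carrier_FactGroup)
  interpret \<phi>: group_hom "Q Mod U" "Q Mod V" \<phi>
    using \<phi> by unfold_locales (simp add: iso_def)
  have \<phi>_bij: "bij_betw \<phi> (carrier (Q Mod U)) (carrier (Q Mod V))"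
    using \<phi> by (simp add: iso_def)
  have fin: "finite (carrier (Q Mod U))"
    using finite_cover \<sigma>_surj by (metis finite_imageI)
  have \<phi>_fit: "\<phi> ` ?\<sigma> ` fitting Q = ?\<tau> ` fitting Q"
    using \<phi>.fitting_iso[OF \<phi>] fitting_quotient U V by simp
  \<comment> \<open>Both images of \<open>M\<close> are the \<open>c\<close>-th terms of their
    quotients, which isomorphisms preserve.\<close>
  have \<phi>_M: "\<phi> ` ?\<sigma> ` M = ?\<tau> ` M"
    using \<phi>.hom_nu[OF fin \<phi>.fitting_iso[OF \<phi>], of c] nu_quotient[OF U] nu_quotient[OF V] by simp

  have "(\<lambda>x. \<phi> (?\<sigma> (q x))) \<in> hom F (Q Mod V)"
    by (intro homI) (simp_all add: \<sigma>.hom_mult del: mult_FactGroup)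
  then interpret \<psi>: group_hom F "Q Mod V" "\<lambda>x. \<phi> (?\<sigma> (q x))"
    by unfold_locales
  have gen_closed: "?gen ` {..<n} \<subseteq> carrier F"
    using free_gen_closed by auto
  have "generate (Q Mod V) ((\<lambda>i. \<phi> (?\<sigma> (q (?gen i)))) ` {..<n}) = (\<lambda>x. \<phi> (?\<sigma> (q x))) ` carrier F"
    using \<psi>.generate_img[OF gen_closed] generate_free_gen[of n] by (simp add: image_image)
  also have "\<dots> = \<phi> ` ?\<sigma> ` q ` carrier F"
    by (simp add: image_image)
  also have "\<dots> = carrier (Q Mod V)"
    unfolding q_surj \<sigma>_surj using \<phi>_bij by (rule bij_betw_imp_surj_on)
  finally have gens: "generate (Q Mod V) ((\<lambda>i. \<phi> (?\<sigma> (q (?gen i)))) ` {..<n}) = carrier (Q Mod V)" .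
  have "(\<lambda>i. q (?gen i)) ` {..<n} \<subseteq> carrier Q"
    using free_gen_closed by auto
  \<comment> \<open>The lifts \<open>z\<close> are chosen to generate \<open>Q\<close>, which makes
    \<open>f\<close> and then \<open>\<alpha>\<close> surjective.\<close>
  from \<tau>.lift_generators[OF finite_cover finite_lessThan \<tau>_surj this generate_q gens]
  obtain z where z: "\<And>i. i < n \<Longrightarrow> z i \<in> carrier Q"
    "\<And>i. i < n \<Longrightarrow> ?\<tau> (z i) = \<phi> (?\<sigma> (q (?gen i)))" "generate Q (z ` {..<n}) = carrier Q"
    unfolding lessThan_iff by metis
  obtain f where f: "f \<in> hom F Q" "\<And>i. i < n \<Longrightarrow> f (?gen i) = z i"
    using q.H.free_group_universal[of n z] z(1) by auto
  interpret f: group_hom F Q f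
    using f(1) by unfold_locales
  have "f ` ?gen ` {..<n} = z ` {..<n}"
    using f(2) by (auto simp: image_image)
  then have f_surj: "f ` carrier F = carrier Q"
    using f.generate_img[OF gen_closed] generate_free_gen[of n] z(3) by simp

  have "(\<lambda>x. ?\<tau> (f x)) \<in> hom F (Q Mod V)"
    by (intro homI) (simp_all add: \<tau>.hom_mult del: mult_FactGroup)
  then have \<tau>f: "group_hom F (Q Mod V) (\<lambda>x. ?\<tau> (f x))"
    by unfold_locales
  \<comment> \<open>Both sides are homomorphisms on the free group that agree on the free
    generators.\<close>
  have comm: "?\<tau> (f x) = \<phi> (?\<sigma> (q x))" if "x \<in> carrier F" for x
  proof (rule hom_eq_on_generators[OF \<tau>f \<psi>.group_hom_axioms gen_closed])
    show "?\<tau> (f s) = \<phi> (?\<sigma> (q s))" if "s \<in> ?gen ` {..<n}" for s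
      using that f(2) z(2) by auto
    show "x \<in> generate F (?gen ` {..<n})"
      using that by (simp add: generate_free_gen)
  qed
  note Msub = normal_imp_subgroup[OF M_normal]
  \<comment> \<open>Modulo \<open>V\<close> the element \<open>f r\<close> lies in the image of
    \<open>M\<close>, and \<open>M\<close> contains \<open>V\<close>, so membership lifts
    back.\<close>
  have fM: "f r \<in> M" if r: "r \<in> R" for r
  proof (rule \<tau>.mem_of_image_mem[OF Msub])
    have "?\<tau> (f r) \<in> \<phi> ` ?\<sigma> ` M"
      unfolding comm[OF R_carrier[OF r]] using r by (simp add: M_eq)
    then show "?\<tau> (f r) \<in> ?\<tau> ` M"
      unfolding \<phi>_M .
  qed (use R_carrier r V(2) \<tau>_ker in auto)
  have fL: "f l \<in> fitting Q" if l: "l \<in> L" for l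
  proof (rule \<tau>.mem_of_image_mem[OF q.H.fitting_subgroup])
    have "q l \<in> fitting Q"
      using l L_carrier[OF l] by (simp add: fitting_cover pr_q cov_L_def)
    then have "?\<tau> (f l) \<in> \<phi> ` ?\<sigma> ` fitting Q"
      unfolding comm[OF L_carrier[OF l]] by simp
    then show "?\<tau> (f l) \<in> ?\<tau> ` fitting Q"
      unfolding \<phi>_fit .
    \<comment> \<open>\<open>V\<close> lies in \<open>M\<close>, which maps to the identity of
      \<open>G\<close> and so lies in \<open>fitting Q\<close>.\<close>
    show "kernel Q (Q Mod V) ?\<tau> \<subseteq> fitting Q"
      using V(2) M_carrier M_fitting unfolding \<tau>_ker fitting_cover by auto
  qed (use L_carrier l in auto)
  \<comment> \<open>The defining relations hold for the new images: \<open>f r\<close> lies in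
    \<open>M\<close>, so it commutes with \<open>f l\<close> from the Fitting subgroup and has
    trivial \<open>k\<close>-th power.\<close>
  have "K \<subseteq> kernel F Q f"
  proof (rule K_subsetI[OF f.subgroup_kernel])
    fix r l assume rl: "r \<in> R" "l \<in> L"
    then have c: "r \<in> carrier F" "l \<in> carrier F" "f r \<in> carrier Q" "f l \<in> carrier Q"
      using R_carrier L_carrier by auto
    have "f r \<otimes>\<^bsub>Q\<^esub> f l = f l \<otimes>\<^bsub>Q\<^esub> f r"
      using M_central fM fL rl unfolding fitting_cover by blast
    then have "f r \<otimes>\<^bsub>Q\<^esub> f l \<otimes>\<^bsub>Q\<^esub> inv\<^bsub>Q\<^esub> f r \<otimes>\<^bsub>Q\<^esub> inv\<^bsub>Q\<^esub> f l = \<one>\<^bsub>Q\<^esub>"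
      using c by (simp add: q.H.m_assoc)
    then show "r \<otimes>\<^bsub>F\<^esub> l \<otimes>\<^bsub>F\<^esub> inv\<^bsub>F\<^esub> r \<otimes>\<^bsub>F\<^esub> inv\<^bsub>F\<^esub> l \<in> kernel F Q f"
      using c by (simp add: kernel_def)
  next
    fix r assume r: "r \<in> R"
    then show "r [^]\<^bsub>F\<^esub> k \<in> kernel F Q f"
      using M_exponent[OF fM[OF r]] R_carrier[OF r] by (simp add: kernel_def f.hom_nat_pow)
  qed
  then obtain \<alpha> where "\<alpha> \<in> hom (F Mod K) Q" "\<And>x. x \<in> carrier F \<Longrightarrow> \<alpha> (K #>\<^bsub>F\<^esub> x) = f x"
    using f.FactGroup_universal_kernel[OF K_normal] by blast
  then have \<alpha>: "\<alpha> \<in> hom Q Q" "\<And>x. x \<in> carrier F \<Longrightarrow> \<alpha> (q x) = f x"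
    by (auto simp: cover_group_def q_def)
  have "\<alpha> ` carrier Q = \<alpha> ` q ` carrier F"
    by (simp only: q_surj)
  also have "\<dots> = f ` carrier F"
    unfolding image_image by (rule image_cong) (auto simp: \<alpha>(2))
  finally have \<alpha>_surj: "\<alpha> ` carrier Q = carrier Q"
    using f_surj by simp
  \<comment> \<open>A surjection of a finite set onto itself is injective.\<close>
  then have \<alpha>_inj: "inj_on \<alpha> (carrier Q)"
    using finite_cover by (intro eq_card_imp_inj_on) simp_all
  have \<alpha>_iso: "\<alpha> \<in> iso Q Q"
    using \<alpha>(1) \<alpha>_surj \<alpha>_inj by (simp add: iso_def bij_betw_def)
  have "\<alpha> ` M \<subseteq> M"
    using fM \<alpha>(2) R_carrier by (auto simp: M_eq)
  \<comment> \<open>Injectivity and finiteness upgrade the inclusion to equality.\<close>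
  then have \<alpha>_M: "\<alpha> ` M = M"
    using \<alpha>_inj M_carrier finite_cover
    by (intro card_seteq) (auto simp: card_image inj_on_subset intro: finite_subset)
  have key: "?\<tau> (\<alpha> x) = \<phi> (?\<sigma> x)" if x: "x \<in> carrier Q" for x
  proof -
    obtain w where "w \<in> carrier F" "x = q w"
      using x q_surj by blast
    then show ?thesis
      using comm \<alpha>(2) by simp
  qed
  have \<alpha>_closed: "\<alpha> x \<in> carrier Q" if "x \<in> carrier Q" for x
    using that \<alpha>_surj by blast
  have U_iff: "y \<in> U \<longleftrightarrow> y \<in> carrier Q \<and> ?\<sigma> y = \<one>\<^bsub>Q Mod U\<^esub>"
    and V_iff: "y \<in> V \<longleftrightarrow> y \<in> carrier Q \<and> ?\<tau> y = \<one>\<^bsub>Q Mod V\<^esub>" for y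
    using \<sigma>_ker \<tau>_ker unfolding kernel_def by blast+
  \<comment> \<open>Injectivity of \<open>\<phi>\<close> transfers triviality modulo
    \<open>V\<close> back to triviality modulo \<open>U\<close>.\<close>
  have mem_iff: "\<alpha> x \<in> V \<longleftrightarrow> x \<in> U" if x: "x \<in> carrier Q" for x
  proof -
    have "\<alpha> x \<in> V \<longleftrightarrow> \<phi> (?\<sigma> x) = \<one>\<^bsub>Q Mod V\<^esub>"
      using V_iff[of "\<alpha> x"] \<alpha>_closed[OF x] key[OF x] by metis
    also have "\<dots> \<longleftrightarrow> ?\<sigma> x = \<one>\<^bsub>Q Mod U\<^esub>"
      using \<phi>_bij inj_onD[of \<phi> "carrier (Q Mod U)" "?\<sigma> x" "\<one>\<^bsub>Q Mod U\<^esub>"]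
        \<sigma>.hom_closed[OF x] \<sigma>.H.one_closed \<phi>.hom_one unfolding bij_betw_def by metis
    also have "\<dots> \<longleftrightarrow> x \<in> U"
      using U_iff[of x] x by metis
    finally show ?thesis .
  qed
  have sub: "U \<subseteq> carrier Q" "V \<subseteq> carrier Q"
    using U(2) V(2) M_carrier by auto
  have "\<alpha> ` U = V"
  proof
    show "\<alpha> ` U \<subseteq> V"
      using mem_iff sub(1) by blast
    show "V \<subseteq> \<alpha> ` U"
    proof
      fix v assume v: "v \<in> V"
      then obtain x where "x \<in> carrier Q" "v = \<alpha> x"
        using sub(2) \<alpha>_surj by blast
      then show "v \<in> \<alpha> ` U"
        using v mem_iff by blast
    qed
  qed
  with \<alpha>_iso \<alpha>_M show ?thesis
    by (rule that)
qed

end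

text \<open>The composite of \<open>\<alpha>\<close> with the projection onto \<open>G Mod V\<close>
  is onto with kernel \<open>U\<close>, so the first isomorphism theorem applies.\<close>

lemma (in group) iso_Mod_image:
  assumes U: "U \<lhd> G" and V: "V \<lhd> G" and \<alpha>: "\<alpha> \<in> iso G G" "\<alpha> ` U = V"
  shows "G Mod U \<cong> G Mod V"
proof -
  let ?\<tau> = "\<lambda>x. V #> x"
  interpret \<tau>: group_hom G "G Mod V" ?\<tau>
    by (rule normal.Mod_hom[OF V])
  interpret \<alpha>: group_hom G G \<alpha>
    using \<alpha>(1) by unfold_locales (simp add: iso_def)
  have bij: "bij_betw \<alpha> (carrier G) (carrier G)"
    using \<alpha>(1) by (simp add: iso_def)
  have "(\<lambda>x. ?\<tau> (\<alpha> x)) \<in> hom G (G Mod V)"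
    by (intro homI) (simp_all add: \<tau>.hom_mult del: mult_FactGroup)
  then interpret h: group_hom G "G Mod V" "\<lambda>x. ?\<tau> (\<alpha> x)"
    by unfold_locales
  have "(\<lambda>x. ?\<tau> (\<alpha> x)) ` carrier G = ?\<tau> ` \<alpha> ` carrier G"
    by (simp add: image_image)
  also have "\<dots> = carrier (G Mod V)"
    using bij_betw_imp_surj_on[OF bij] by (simp add: carrier_FactGroup)
  finally have surj: "(\<lambda>x. ?\<tau> (\<alpha> x)) ` carrier G = carrier (G Mod V)" .
  have Uc: "U \<subseteq> carrier G"
    using normal_imp_subgroup[OF U] by (rule subgroup.subset)
  have "kernel G (G Mod V) (\<lambda>x. ?\<tau> (\<alpha> x)) = {x \<in> carrier G. \<alpha> x \<in> kernel G (G Mod V) ?\<tau>}"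
    by (auto simp: kernel_def)
  also have "\<dots> = {x \<in> carrier G. \<alpha> x \<in> \<alpha> ` U}"
    by (simp only: normal.Mod_kernel[OF V] \<alpha>(2))
  also have "\<dots> = U"
    using Uc bij unfolding bij_betw_def by (auto dest: inj_onD)
  finally show ?thesis
    using h.FactGroup_iso[OF surj] by simp
qed

theorem theorem4p8:
  fixes G :: "('a,'b) monoid_scheme" and n :: nat and g :: "nat \<Rightarrow> 'a"
    and \<mu> :: "fword set \<Rightarrow> 'a" and U1 U2 :: "fword set set set"
  assumes "group G" and "finite (carrier G)"
    and "\<forall>i<n. g i \<in> carrier G"
    and "generate G (g ` {..<n}) = carrier G"
    and "\<mu> \<in> hom (free_group n) G"
    and "\<forall>i<n. \<mu> (free_gen n i) = g i"
    and "Fclass G \<ge> 1"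
    and "allowable G n \<mu> U1" and "allowable G n \<mu> U2"
  shows "(cover_group G n \<mu> Mod U1 \<cong> cover_group G n \<mu> Mod U2) \<longleftrightarrow>
         (\<exists>\<alpha>\<in>Aut_M G n \<mu>. \<alpha> ` U1 = U2)"
proof -
  interpret \<mu>: group_hom "free_group n" G \<mu>
    using assms(1,5) group_free_group by (intro group_hom.intro group_hom_axioms.intro)
  have "\<mu> ` free_gen n ` {..<n} = g ` {..<n}"
    using assms(6) by (auto simp: image_image)
  moreover have "generate G (\<mu> ` free_gen n ` {..<n}) = \<mu> ` carrier (free_group n)"
    using \<mu>.generate_img[of "free_gen n ` {..<n}"] free_gen_closed generate_free_gen[of n] by auto
  \<comment> \<open>The \<open>g i\<close> are the images of the free generators, so generation of
    \<open>G\<close> makes \<open>\<mu>\<close> surjective, as the locale requires.\<close>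
  ultimately have "\<mu> ` carrier (free_group n) = carrier G"
    using assms(4) by simp
  then interpret covering G n \<mu>
    using assms(1,2,5) by unfold_locales
  \<comment> \<open>The nucleus is the term of index \<open>Fclass G\<close>, so one common index
    serves both quotients.\<close>
  have U1: "U1 \<lhd> Q" "U1 \<subseteq> M" "M = nu Q (Fclass G) <#>\<^bsub>Q\<^esub> U1"
    and U2: "U2 \<lhd> Q" "U2 \<subseteq> M" "M = nu Q (Fclass G) <#>\<^bsub>Q\<^esub> U2"
    using assms(8,9) unfolding allowable_def nucleus_def by auto
  show ?thesis
  proof
    assume "Q Mod U1 \<cong> Q Mod U2"
    then obtain \<phi> where "\<phi> \<in> iso (Q Mod U1) (Q Mod U2)"
      by (auto simp: is_iso_def)
    from iso_quotients_lift[OF U1 U2 this] obtain \<alpha>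
      where "\<alpha> \<in> iso Q Q" "\<alpha> ` M = M" "\<alpha> ` U1 = U2" .
    then show "\<exists>\<alpha>\<in>Aut_M G n \<mu>. \<alpha> ` U1 = U2"
      by (auto simp: Aut_M_def)
  next
    assume "\<exists>\<alpha>\<in>Aut_M G n \<mu>. \<alpha> ` U1 = U2"
    then obtain \<alpha> where "\<alpha> \<in> iso Q Q" "\<alpha> ` U1 = U2"
      by (auto simp: Aut_M_def)
    then show "Q Mod U1 \<cong> Q Mod U2"
      by (rule q.H.iso_Mod_image[OF U1(1) U2(1)])
  qed
qed

end
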